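(* Let $A=W_1^{rsym}$, if the ground field $\mathcal K$ has characteristic $p=0$, and $A=W_1^{rsym}(m)$, if $p>0$. Then the second right-symmetric cohomology space $H^2_{rsym}(A,\mathcal K)$ with coefficients in the trivial module has dimension $1$ and is generated by the class of the cocycle $\vartheta$ given by $$\vartheta(e_i,e_j)=-(j+1)j\,\delta_{i+j,-1}\quad\text{if }p=0,\qquad \vartheta(e_i,e_j)=-(-1)^i\delta_{i+j,p^m-1}\quad\text{if }p>0.$$ If $A$ is considered as a Novikov algebra, then any Novikov central extension is split: $H^2_{nov}(A,\mathcal K)=0$.
   Context: $W_1^{rsym}$ ($p=0$) is the algebra with basis $e_i$, $i\in\mathbb Z$, and product $e_i\circ e_j=(i+1)e_{i+j}$ (realized by $e_i=x^{i+1}\partial$ with $u\partial\circ v\partial=v\partial(u)\partial$). $W_1^{rsym}(m)$ ($p>0$, $m\ge1$) is the algebra with basis $e_i$, $-1\le i\le p^m-2$, and product $e_i\circ e_j=\binom{i+j+1}{i}e_{i+j}$ (with $e_k=0$ for $k$ outside the range and $\binom{N}{-1}=0$), realized by $e_i=x^{(i+1)}\partial$ in divided powers. These algebras are right-symmetric ($a\circ(b\circ c)-(a\circ b)\circ c$ is symmetric in $b,c$) and Novikov (in addition $a\circ(b\circ c)=b\circ(a\circ c)$). With $[a,b]=a\circ b-b\circ a$, $H^2_{rsym}(A,\mathcal K)=Z^2_{rsym}/B^2$, where $Z^2_{rsym}$ is the space of bilinear $\psi:A\times A\to\mathcal K$ with $-\psi(a\circ b,c)+\psi(a\circ c,b)+\psi(a,[b,c])=0$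 for all $a,b,c$, and $B^2$ is the space of maps $(a,b)\mapsto-\omega(a\circ b)$ with $\omega:A\to\mathcal K$ linear. $H^2_{nov}(A,\mathcal K)=Z^2_{nov}/B^2$, where $Z^2_{nov}$ consists of those $\psi\in Z^2_{rsym}$ with $\psi(a,b\circ c)=\psi(b,a\circ c)$ for all $a,b,c$; it classifies central extensions by $\mathcal K$ in the category of Novikov algebras.
   Formalization: The claim that the right-symmetric cohomology has dimension 1 and is generated by the class of ϑ is stated in characteristic 2 only for m = 2, since it fails there for m = 1 (ϑ = 0) and for m ≥ 3 (the dimension is at least m − 1). *)

theory Defs
  imports "Jordan_Normal_Form.VS_Connect" "HOL-Algebra.AbelCoset" "HOL-Library.Poly_Mapping"
begin

text \<open>
  The ground field is a type \<open>'k\<close> of class \<open>field\<close>; \<open>class_ring\<close> is the corresponding ring record.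
  A nonassociative algebra is represented by the record type \<open>module\<close> with product \<open>mult\<close>; the field
  \<open>one\<close> (and, in pure vector spaces, \<open>mult\<close>) carries no meaning and is left undefined.
\<close>

section \<open>Right-symmetric and Novikov algebras\<close>

definition commutator :: "('k, 'a) module \<Rightarrow> 'a \<Rightarrow> 'a \<Rightarrow> 'a" where
  "commutator A a b = (a \<otimes>\<^bsub>A\<^esub> b) \<ominus>\<^bsub>A\<^esub> (b \<otimes>\<^bsub>A\<^esub> a)"

definition nonassoc_algebra :: "('k::field, 'a) module \<Rightarrow> bool" where
  "nonassoc_algebra A \<longleftrightarrow> vectorspace class_ring A \<and>
     (\<forall>a\<in>carrier A. (\<lambda>b. a \<otimes>\<^bsub>A\<^esub> b) \<in> LinearCombinations.module_hom class_ring A A) \<and>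
     (\<forall>b\<in>carrier A. (\<lambda>a. a \<otimes>\<^bsub>A\<^esub> b) \<in> LinearCombinations.module_hom class_ring A A)"

definition right_symmetric :: "('k::field, 'a) module \<Rightarrow> bool" where
  "right_symmetric A \<longleftrightarrow> nonassoc_algebra A \<and>
     (\<forall>a\<in>carrier A. \<forall>b\<in>carrier A. \<forall>c\<in>carrier A.
        (a \<otimes>\<^bsub>A\<^esub> (b \<otimes>\<^bsub>A\<^esub> c)) \<ominus>\<^bsub>A\<^esub> ((a \<otimes>\<^bsub>A\<^esub> b) \<otimes>\<^bsub>A\<^esub> c) =
        (a \<otimes>\<^bsub>A\<^esub> (c \<otimes>\<^bsub>A\<^esub> b)) \<ominus>\<^bsub>A\<^esub> ((a \<otimes>\<^bsub>A\<^esub> c) \<otimes>\<^bsub>A\<^esub> b))"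

definition novikov :: "('k::field, 'a) module \<Rightarrow> bool" where
  "novikov A \<longleftrightarrow> right_symmetric A \<and>
     (\<forall>a\<in>carrier A. \<forall>b\<in>carrier A. \<forall>c\<in>carrier A.
        a \<otimes>\<^bsub>A\<^esub> (b \<otimes>\<^bsub>A\<^esub> c) = b \<otimes>\<^bsub>A\<^esub> (a \<otimes>\<^bsub>A\<^esub> c))"

definition alg_hom :: "('k::field, 'a) module \<Rightarrow> ('k, 'b) module \<Rightarrow> ('a \<Rightarrow> 'b) set" where
  "alg_hom A B = {f \<in> LinearCombinations.module_hom class_ring A B.
     \<forall>a\<in>carrier A. \<forall>b\<in>carrier A. f (a \<otimes>\<^bsub>A\<^esub> b) = f a \<otimes>\<^bsub>B\<^esub> f b}"


section \<open>Second cohomology with trivial coefficients\<close>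

definition field_module :: "('k::field, 'k) module" where
  "field_module = \<lparr>carrier = UNIV, mult = (*), one = 1, zero = 0, add = (+), smult = (*)\<rparr>"

definition quotient_module :: "('k, 'v) module \<Rightarrow> 'v set \<Rightarrow> ('k, 'v set) module" where
  "quotient_module V B =
     \<lparr>carrier = a_rcosets\<^bsub>V\<^esub> B, mult = undefined, one = undefined, zero = B,
      add = (<+>\<^bsub>V\<^esub>), smult = (\<lambda>c X. \<Union>x\<in>X. B +>\<^bsub>V\<^esub> (c \<odot>\<^bsub>V\<^esub> x))\<rparr>"

text \<open>
  Bilinear maps on the carrier of \<open>A\<close> are made unique as HOL functions by requiring them to vanish
  outside of the carrier.
\<close>

definition bilinear_forms :: "('k::field, 'a) module \<Rightarrow> ('k, 'a \<Rightarrow> 'a \<Rightarrow> 'k) module" where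
  "bilinear_forms A =
     \<lparr>carrier = {\<psi>. (\<forall>a\<in>carrier A. (\<lambda>b. \<psi> a b) \<in> LinearCombinations.module_hom class_ring A field_module) \<and>
                    (\<forall>b\<in>carrier A. (\<lambda>a. \<psi> a b) \<in> LinearCombinations.module_hom class_ring A field_module) \<and>
                    (\<forall>a b. a \<notin> carrier A \<or> b \<notin> carrier A \<longrightarrow> \<psi> a b = 0)},
      mult = undefined, one = undefined, zero = (\<lambda>a b. 0),
      add = (\<lambda>\<psi> \<phi> a b. \<psi> a b + \<phi> a b), smult = (\<lambda>c \<psi> a b. c * \<psi> a b)\<rparr>"

definition Z2_rsym :: "('k::field, 'a) module \<Rightarrow> ('a \<Rightarrow> 'a \<Rightarrow> 'k) set" where
  "Z2_rsym A = {\<psi> \<in> carrier (bilinear_forms A).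
     \<forall>a\<in>carrier A. \<forall>b\<in>carrier A. \<forall>c\<in>carrier A.
       - \<psi> (a \<otimes>\<^bsub>A\<^esub> b) c + \<psi> (a \<otimes>\<^bsub>A\<^esub> c) b + \<psi> a (commutator A b c) = 0}"

definition Z2_nov :: "('k::field, 'a) module \<Rightarrow> ('a \<Rightarrow> 'a \<Rightarrow> 'k) set" where
  "Z2_nov A = {\<psi> \<in> Z2_rsym A.
     \<forall>a\<in>carrier A. \<forall>b\<in>carrier A. \<forall>c\<in>carrier A. \<psi> a (b \<otimes>\<^bsub>A\<^esub> c) = \<psi> b (a \<otimes>\<^bsub>A\<^esub> c)}"

definition B2 :: "('k::field, 'a) module \<Rightarrow> ('a \<Rightarrow> 'a \<Rightarrow> 'k) set" where
  "B2 A = {(\<lambda>a b. if a \<in> carrier A \<and> b \<in> carrier A then - \<omega> (a \<otimes>\<^bsub>A\<^esub> b) else 0) | \<omega>.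
             \<omega> \<in> LinearCombinations.module_hom class_ring A field_module}"

definition H2_rsym :: "('k::field, 'a) module \<Rightarrow> ('k, ('a \<Rightarrow> 'a \<Rightarrow> 'k) set) module" where
  "H2_rsym A = quotient_module (bilinear_forms A\<lparr>carrier := Z2_rsym A\<rparr>) (B2 A)"

definition H2_nov :: "('k::field, 'a) module \<Rightarrow> ('k, ('a \<Rightarrow> 'a \<Rightarrow> 'k) set) module" where
  "H2_nov A = quotient_module (bilinear_forms A\<lparr>carrier := Z2_nov A\<rparr>) (B2 A)"

definition cohomology_class :: "('k::field, 'a) module \<Rightarrow> ('a \<Rightarrow> 'a \<Rightarrow> 'k) \<Rightarrow> ('a \<Rightarrow> 'a \<Rightarrow> 'k) set" where
  "cohomology_class A \<psi> = B2 A +>\<^bsub>bilinear_forms A\<^esub> \<psi>"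


section \<open>Central extensions\<close>

text \<open>
  A Novikov central extension of \<open>A\<close> by the ground field is an exact sequence
  \<open>0 \<rightarrow> K \<rightarrow> E \<rightarrow> A \<rightarrow> 0\<close> with \<open>E\<close> a Novikov algebra in which the image of \<open>K\<close> multiplies to \<open>0\<close>
  from both sides.
\<close>

definition novikov_central_extension ::
    "('k::field, 'a) module \<Rightarrow> ('k, 'e) module \<Rightarrow> ('k \<Rightarrow> 'e) \<Rightarrow> ('e \<Rightarrow> 'a) \<Rightarrow> bool" where
  "novikov_central_extension A E \<iota> \<pi> \<longleftrightarrow>
     novikov E \<and>
     \<iota> \<in> LinearCombinations.module_hom class_ring field_module E \<and> inj \<iota> \<and>
     \<pi> \<in> alg_hom E A \<and> \<pi> ` carrier E = carrier A \<and>
     range \<iota> = {x \<in> carrier E. \<pi> x = \<zero>\<^bsub>A\<^esub>} \<and>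
     (\<forall>t. \<forall>x\<in>carrier E. \<iota> t \<otimes>\<^bsub>E\<^esub> x = \<zero>\<^bsub>E\<^esub> \<and> x \<otimes>\<^bsub>E\<^esub> \<iota> t = \<zero>\<^bsub>E\<^esub>)"

definition split_extension :: "('k::field, 'a) module \<Rightarrow> ('k, 'e) module \<Rightarrow> ('e \<Rightarrow> 'a) \<Rightarrow> bool" where
  "split_extension A E \<pi> \<longleftrightarrow> (\<exists>\<sigma>\<in>alg_hom A E. \<forall>a\<in>carrier A. \<pi> (\<sigma> a) = a)"


section \<open>The algebras and the cocycles\<close>

text \<open>
  \<open>graded_algebra I \<gamma>\<close> is the algebra with basis \<open>e\<^sub>i\<close> (\<open>i \<in> I\<close>) and product
  \<open>e\<^sub>i \<circ> e\<^sub>j = \<gamma> i j e\<^bsub>i+j\<^esub>\<close>, where \<open>e\<^sub>k = 0\<close> for \<open>k \<notin> I\<close>. Its elements are the finitely supported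
  coefficient functions with support in \<open>I\<close>, and \<open>e\<^sub>i\<close> is \<open>Poly_Mapping.single i 1\<close>.
\<close>

definition graded_algebra ::
    "int set \<Rightarrow> (int \<Rightarrow> int \<Rightarrow> 'k::field) \<Rightarrow> ('k, int \<Rightarrow>\<^sub>0 'k) module" where
  "graded_algebra I \<gamma> =
     \<lparr>carrier = {a. Poly_Mapping.keys a \<subseteq> I},
      mult = (\<lambda>a b. \<Sum>i\<in>Poly_Mapping.keys a. \<Sum>j\<in>Poly_Mapping.keys b.
                if i + j \<in> I then Poly_Mapping.single (i + j) (\<gamma> i j * Poly_Mapping.lookup a i * Poly_Mapping.lookup b j) else 0),
      one = undefined, zero = 0, add = (+), smult = (\<lambda>c a. Poly_Mapping.map (\<lambda>x. c * x) a)\<rparr>"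

definition graded_form ::
    "int set \<Rightarrow> (int \<Rightarrow> int \<Rightarrow> 'k::field) \<Rightarrow> (int \<Rightarrow>\<^sub>0 'k) \<Rightarrow> (int \<Rightarrow>\<^sub>0 'k) \<Rightarrow> 'k" where
  "graded_form I f a b =
     (if Poly_Mapping.keys a \<subseteq> I \<and> Poly_Mapping.keys b \<subseteq> I
      then \<Sum>i\<in>Poly_Mapping.keys a. \<Sum>j\<in>Poly_Mapping.keys b. Poly_Mapping.lookup a i * Poly_Mapping.lookup b j * f i j else 0)"

lemma graded_algebra_basis_mult:
  assumes "i \<in> I" "j \<in> I"
  shows "Poly_Mapping.single i 1 \<otimes>\<^bsub>graded_algebra I \<gamma>\<^esub> Poly_Mapping.single j 1 =
    (if i + j \<in> I then Poly_Mapping.single (i + j) (\<gamma> i j) else 0)"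
  using assms by (simp add: graded_algebra_def)

lemma graded_form_basis:
  assumes "i \<in> I" "j \<in> I"
  shows "graded_form I f (Poly_Mapping.single i 1) (Poly_Mapping.single j 1) = f i j"
  using assms by (simp add: graded_form_def)

definition W1_rsym :: "('k::field, int \<Rightarrow>\<^sub>0 'k) module" where
  "W1_rsym = graded_algebra UNIV (\<lambda>i j. of_int (i + 1))"

definition W1_index :: "nat \<Rightarrow> nat \<Rightarrow> int set" where
  "W1_index p m = {-1 .. int (p ^ m) - 2}"

text \<open>
  The convention \<open>binom(N, -1) = 0\<close> is made explicit because \<open>nat (-1) = 0\<close>; for \<open>i \<ge> 0\<close> and
  \<open>j \<ge> -1\<close> the upper entry is nonnegative.
\<close>

definition W1_rsym_trunc :: "nat \<Rightarrow> ('k::field, int \<Rightarrow>\<^sub>0 'k) module" where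
  "W1_rsym_trunc m = graded_algebra (W1_index CHAR('k) m)
     (\<lambda>i j. if i = -1 then 0 else of_nat (nat (i + j + 1) choose nat i))"

definition theta :: "(int \<Rightarrow>\<^sub>0 'k::field) \<Rightarrow> (int \<Rightarrow>\<^sub>0 'k) \<Rightarrow> 'k" where
  "theta = graded_form UNIV (\<lambda>i j. if i + j = -1 then - of_int ((j + 1) * j) else 0)"

definition theta_trunc :: "nat \<Rightarrow> (int \<Rightarrow>\<^sub>0 'k::field) \<Rightarrow> (int \<Rightarrow>\<^sub>0 'k) \<Rightarrow> 'k" where
  "theta_trunc m = graded_form (W1_index CHAR('k) m)
     (\<lambda>i j. if i + j = int (CHAR('k) ^ m) - 1 then - ((-1) powi i) else 0)"

text \<open>
  In characteristic 2 the space \<open>H2_rsym (W1_rsym_trunc m)\<close> is not always one-dimensional. For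
  \<open>m = 1\<close> no indices satisfy \<open>i + j = p\<^sup>m - 1\<close>, so that \<open>\<vartheta> = 0\<close>. For \<open>m = 3\<close> the form with
  \<open>\<psi>(e\<^sub>i, e\<^sub>j) = 1\<close> if \<open>i + j = 9\<close> and \<open>0\<close> otherwise is a cocycle whose class is not a multiple of
  that of \<open>\<vartheta>\<close>, which lives on \<open>i + j = 7\<close>.
\<close>

lemma theta_trunc_eq_0:
  assumes "CHAR('k::field) = 2"
  shows "theta_trunc 1 = (\<lambda>a b. 0 :: 'k)"
proof -
  have "(\<Sum>i\<in>Poly_Mapping.keys a. \<Sum>j\<in>Poly_Mapping.keys b.
           Poly_Mapping.lookup a i * Poly_Mapping.lookup b j *
             (if i + j = 1 then - ((-1) powi i) else 0)) = 0"
    if a: "Poly_Mapping.keys a \<subseteq> {-1..0}" and b: "Poly_Mapping.keys b \<subseteq> {-1..0}"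
    for a b :: "int \<Rightarrow>\<^sub>0 'k"
  proof (intro sum.neutral ballI)
    fix i j assume "i \<in> Poly_Mapping.keys a" "j \<in> Poly_Mapping.keys b"
    hence "i \<le> 0" "j \<le> 0" using a b by auto
    hence "i + j \<noteq> 1" by linarith
    thus "Poly_Mapping.lookup a i * Poly_Mapping.lookup b j *
            (if i + j = 1 then - ((-1) powi i) else 0) = 0"
      by (simp only: if_False mult_zero_right)
  qed
  thus ?thesis
    using assms by (intro ext) (simp add: theta_trunc_def graded_form_def W1_index_def)
qed

end

theory Submission
  imports Defs
begin

text \<open>
  \<^bold>\<open>Novikov cocycles and extensions.\<close> Both algebras are Novikov algebras, and \<open>e\<^sub>0\<close> is a left unit. In
  a Novikov algebra with left unit \<open>u\<close> the Novikov identity \<open>\<psi>(a, u \<circ> b) = \<psi>(u, a \<circ> b)\<close> says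
  \<open>\<psi>(a, b) = \<psi>(u, a \<circ> b)\<close>, so \<open>\<psi>\<close> is a coboundary (\<open>Z2_nov_eq_B2\<close>). For a central extension
  \<open>\<pi> : E \<rightarrow> A\<close> choose \<open>U\<close> over \<open>u\<close>. The product of \<open>U\<close> with a lift of \<open>a\<close> does not depend on the lift,
  since the kernel annihilates \<open>E\<close>; call it \<open>\<sigma>(a)\<close>. The Novikov identity of \<open>E\<close> makes \<open>\<sigma>\<close> a homomorphism,
  and it is a section because \<open>u\<close> is a left unit (\<open>novikov_extension_splits\<close>).

  \<^bold>\<open>Right-symmetric cocycles.\<close> A bilinear form is given by its values \<open>f(i, j) = \<psi>(e\<^sub>i, e\<^sub>j)\<close>, and each
  instance of the cocycle condition on basis elements relates values with the same degree \<open>s = i + j\<close>.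
  The degrees can therefore be treated one at a time.

  In characteristic \<open>0\<close> the condition with \<open>c = e\<^sub>0\<close> reads \<open>(s + 1) f(i, j) = (i + 1) f(s, 0)\<close>, which is
  a coboundary unless \<open>s = -1\<close>. In degree \<open>-1\<close> the conditions with \<open>e\<^sub>1\<close> and \<open>e\<^bsub>-1\<^esub>\<close> are recursions for
  \<open>g(j) = f(-1-j, j)\<close> in both directions; their solutions are spanned by \<open>j\<close>, a coboundary, and
  \<open>(j + 1) j\<close>, which is \<open>-\<vartheta>\<close> (\<open>cocycle_coeffs_char_0\<close>).

  In characteristic \<open>p\<close> put \<open>q = p\<^sup>m\<close>. The element \<open>e\<^bsub>-1\<^esub> = \<partial>\<close> gives
  \<open>f(i-1, j) + f(i, j-1) = \<gamma>(i, j) f(i+j, -1)\<close> for \<open>i, j \<ge> 0\<close>, where the right-hand side is absent if \<open>i + j\<close> exceeds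
  \<open>q - 2\<close>. For \<open>-1 \<le> s \<le> q - 3\<close> this is Pascal's rule, and it forces \<open>f(i, j) = \<gamma>(i, j) f(s+1, -1)\<close>, a
  coboundary (\<open>low_degree\<close>). For \<open>s \<ge> q - 1\<close> it says that \<open>f\<close> alternates in sign, so that each such
  degree has at most one free parameter; the cocycle \<open>\<vartheta>\<close> is the solution in degree \<open>q - 1\<close>
  (\<open>degree_q_minus_1\<close>). In the degrees \<open>s \<ge> q\<close> the conditions with \<open>e\<^sub>0\<close> and \<open>e\<^sub>1\<close> give \<open>f = 0\<close> if \<open>p\<close> is odd
  (\<open>high_degree\<close>); if \<open>q = 4\<close> the only such degree is \<open>s = 4\<close>, and \<open>e\<^sub>0\<close> suffices. The remaining degrees
  \<open>-2\<close> and \<open>q - 2\<close> are settled by \<open>e\<^sub>0\<close>, because \<open>s + 1 = -1\<close> in the field.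

  That \<open>\<vartheta>\<close> is a cocycle is integration by parts: with \<open>e\<^sub>i = x\<^sup>(\<^sup>i\<^sup>+\<^sup>1\<^sup>)\<partial>\<close> the value \<open>\<vartheta>(u\<partial>, v\<partial>)\<close> is the
  coefficient of \<open>x\<^sup>(\<^sup>q\<^sup>-\<^sup>1\<^sup>)\<close> in \<open>u v''\<close>, and this coefficient vanishes on derivatives. In coordinates this
  becomes the congruence \<open>of_nat_choose_reflect\<close>.
\<close>

section \<open>Quotients of vector spaces\<close>

lemma vectorspace_class_ringI:
  fixes V :: "('k::field, 'v) module"
  assumes "abelian_group V"
    and "\<And>c x. x \<in> carrier V \<Longrightarrow> c \<odot>\<^bsub>V\<^esub> x \<in> carrier V"
    and "\<And>c d x. x \<in> carrier V \<Longrightarrow> (c + d) \<odot>\<^bsub>V\<^esub> x = c \<odot>\<^bsub>V\<^esub> x \<oplus>\<^bsub>V\<^esub> d \<odot>\<^bsub>V\<^esub> x"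
    and "\<And>c x y. x \<in> carrier V \<Longrightarrow> y \<in> carrier V \<Longrightarrow>
           c \<odot>\<^bsub>V\<^esub> (x \<oplus>\<^bsub>V\<^esub> y) = c \<odot>\<^bsub>V\<^esub> x \<oplus>\<^bsub>V\<^esub> c \<odot>\<^bsub>V\<^esub> y"
    and "\<And>c d x. x \<in> carrier V \<Longrightarrow> (c * d) \<odot>\<^bsub>V\<^esub> x = c \<odot>\<^bsub>V\<^esub> (d \<odot>\<^bsub>V\<^esub> x)"
    and "\<And>x. x \<in> carrier V \<Longrightarrow> 1 \<odot>\<^bsub>V\<^esub> x = x"
  shows "vectorspace class_ring V"
proof -
  have "Module.module (class_ring :: 'k ring) V"
    using assms by (intro moduleI class_cring.cring_axioms) simp_all
  thus ?thesis
    by (intro vectorspace.intro class_field)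
qed

locale linear_quotient =
  fixes V :: "('k::field, 'v) module" and B :: "'v set"
  assumes vs: "vectorspace class_ring V"
    and sub: "B \<subseteq> carrier V"
    and zero_mem: "\<zero>\<^bsub>V\<^esub> \<in> B"
    and add_mem: "\<And>x y. x \<in> B \<Longrightarrow> y \<in> B \<Longrightarrow> x \<oplus>\<^bsub>V\<^esub> y \<in> B"
    and smult_mem: "\<And>c x. x \<in> B \<Longrightarrow> c \<odot>\<^bsub>V\<^esub> x \<in> B"
begin

sublocale V: vectorspace class_ring V
  by (rule vs)

lemma smult_simps:
  "x \<in> carrier V \<Longrightarrow> c \<odot>\<^bsub>V\<^esub> x \<in> carrier V"
  "x \<in> carrier V \<Longrightarrow> y \<in> carrier V \<Longrightarrow> c \<odot>\<^bsub>V\<^esub> (x \<oplus>\<^bsub>V\<^esub> y) = c \<odot>\<^bsub>V\<^esub> x \<oplus>\<^bsub>V\<^esub> c \<odot>\<^bsub>V\<^esub> y"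
  "x \<in> carrier V \<Longrightarrow> (c + d) \<odot>\<^bsub>V\<^esub> x = c \<odot>\<^bsub>V\<^esub> x \<oplus>\<^bsub>V\<^esub> d \<odot>\<^bsub>V\<^esub> x"
  "x \<in> carrier V \<Longrightarrow> (c * d) \<odot>\<^bsub>V\<^esub> x = c \<odot>\<^bsub>V\<^esub> (d \<odot>\<^bsub>V\<^esub> x)"
  "x \<in> carrier V \<Longrightarrow> 1 \<odot>\<^bsub>V\<^esub> x = x"
  using V.smult_closed[of c x] V.smult_r_distr[of c x y] V.smult_l_distr[of c d x]
    V.smult_assoc1[of c d x] V.smult_one[of x] by simp_all

lemma uminus_mem: "x \<in> B \<Longrightarrow> \<ominus>\<^bsub>V\<^esub> x \<in> B"
  using smult_mem[of x "- 1"] V.smult_minus_1[of x] sub by (auto simp: class_ring_simps)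

sublocale B: abelian_subgroup B V
proof (rule abelian_subgroupI3)
  show "additive_subgroup B V"
    using sub zero_mem add_mem uminus_mem
    by (intro additive_subgroup.intro V.add.subgroupI) (auto simp: a_inv_def)
qed (rule V.abelian_group_axioms)

abbreviation Q where "Q \<equiv> quotient_module V B"

lemma Q_simps:
  "carrier Q = (\<lambda>x. B +>\<^bsub>V\<^esub> x) ` carrier V" "\<zero>\<^bsub>Q\<^esub> = B"
  by (auto simp: quotient_module_def A_RCOSETS_def' a_r_coset_def')

lemma coset_mem: "x \<in> carrier V \<Longrightarrow> B +>\<^bsub>V\<^esub> x \<in> carrier Q"
  by (simp add: Q_simps)

lemma carrier_Q_cases:
  assumes "X \<in> carrier Q"
  obtains x where "x \<in> carrier V" "X = B +>\<^bsub>V\<^esub> x"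
  using assms by (auto simp: Q_simps)

lemma Q_add: "x \<in> carrier V \<Longrightarrow> y \<in> carrier V \<Longrightarrow>
    (B +>\<^bsub>V\<^esub> x) \<oplus>\<^bsub>Q\<^esub> (B +>\<^bsub>V\<^esub> y) = B +>\<^bsub>V\<^esub> (x \<oplus>\<^bsub>V\<^esub> y)"
  by (simp add: quotient_module_def B.a_rcos_sum)

lemma coset_add_left: "b \<in> B \<Longrightarrow> x \<in> carrier V \<Longrightarrow> B +>\<^bsub>V\<^esub> (b \<oplus>\<^bsub>V\<^esub> x) = B +>\<^bsub>V\<^esub> x"
  using sub V.a_coset_add_assoc[of B b x, symmetric] B.a_rcos_const[of b] by auto

lemma Q_smult:
  assumes "x \<in> carrier V"
  shows "c \<odot>\<^bsub>Q\<^esub> (B +>\<^bsub>V\<^esub> x) = B +>\<^bsub>V\<^esub> (c \<odot>\<^bsub>V\<^esub> x)"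
proof -
  have "B +>\<^bsub>V\<^esub> (c \<odot>\<^bsub>V\<^esub> y) = B +>\<^bsub>V\<^esub> (c \<odot>\<^bsub>V\<^esub> x)" if y: "y \<in> B +>\<^bsub>V\<^esub> x" for y
  proof -
    obtain b where "b \<in> B" "y = b \<oplus>\<^bsub>V\<^esub> x"
      using y by (auto simp: a_r_coset_def')
    thus ?thesis
      using assms sub smult_mem by (auto simp: smult_simps coset_add_left)
  qed
  moreover have "x \<in> B +>\<^bsub>V\<^esub> x"
    using assms by (rule B.a_rcos_self)
  ultimately have "(\<Union>y\<in>B +>\<^bsub>V\<^esub> x. B +>\<^bsub>V\<^esub> (c \<odot>\<^bsub>V\<^esub> y)) = B +>\<^bsub>V\<^esub> (c \<odot>\<^bsub>V\<^esub> x)"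
    by (intro SUP_eq_const) blast+
  thus ?thesis
    by (simp add: quotient_module_def)
qed

lemma coset_eq_B_iff: "x \<in> carrier V \<Longrightarrow> B +>\<^bsub>V\<^esub> x = B \<longleftrightarrow> x \<in> B"
  using B.a_rcos_const[of x] B.a_rcos_self[of x] by auto

lemma abelian_group_quotient: "abelian_group Q"
proof (rule abelian_groupI)
  have zero: "B = B +>\<^bsub>V\<^esub> \<zero>\<^bsub>V\<^esub>"
    by (simp add: sub V.a_coset_add_zero)
  show "\<zero>\<^bsub>Q\<^esub> \<in> carrier Q"
    using zero coset_mem[of "\<zero>\<^bsub>V\<^esub>"] by (simp add: Q_simps(2))
  show "\<zero>\<^bsub>Q\<^esub> \<oplus>\<^bsub>Q\<^esub> X = X" if X: "X \<in> carrier Q" for X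
  proof -
    obtain x where x: "x \<in> carrier V" "X = B +>\<^bsub>V\<^esub> x"
      using X by (elim carrier_Q_cases)
    have "\<zero>\<^bsub>Q\<^esub> \<oplus>\<^bsub>Q\<^esub> X = (B +>\<^bsub>V\<^esub> \<zero>\<^bsub>V\<^esub>) \<oplus>\<^bsub>Q\<^esub> X"
      using zero by (simp add: Q_simps)
    also have "\<dots> = X"
      using x by (simp add: Q_add)
    finally show ?thesis .
  qed
  show "\<exists>Y\<in>carrier Q. Y \<oplus>\<^bsub>Q\<^esub> X = \<zero>\<^bsub>Q\<^esub>" if X: "X \<in> carrier Q" for X
  proof -
    obtain x where x: "x \<in> carrier V" "X = B +>\<^bsub>V\<^esub> x"
      using X by (elim carrier_Q_cases)
    have "(B +>\<^bsub>V\<^esub> (\<ominus>\<^bsub>V\<^esub> x)) \<oplus>\<^bsub>Q\<^esub> X = \<zero>\<^bsub>Q\<^esub>"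
      using x zero by (simp add: Q_add V.l_neg Q_simps)
    moreover have "B +>\<^bsub>V\<^esub> (\<ominus>\<^bsub>V\<^esub> x) \<in> carrier Q"
      using x by (simp add: coset_mem)
    ultimately show ?thesis by blast
  qed
  show "X \<oplus>\<^bsub>Q\<^esub> Y = Y \<oplus>\<^bsub>Q\<^esub> X" if "X \<in> carrier Q" "Y \<in> carrier Q" for X Y
    using that by (elim carrier_Q_cases) (simp add: Q_add V.a_comm)
  show "X \<oplus>\<^bsub>Q\<^esub> Y \<in> carrier Q" if "X \<in> carrier Q" "Y \<in> carrier Q" for X Y
    using that by (elim carrier_Q_cases) (simp add: Q_add coset_mem)
  show "X \<oplus>\<^bsub>Q\<^esub> Y \<oplus>\<^bsub>Q\<^esub> Z = X \<oplus>\<^bsub>Q\<^esub> (Y \<oplus>\<^bsub>Q\<^esub> Z)"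
    if "X \<in> carrier Q" "Y \<in> carrier Q" "Z \<in> carrier Q" for X Y Z
    using that by (elim carrier_Q_cases) (simp add: Q_add V.a_assoc)
qed

lemma vectorspace_quotient: "vectorspace class_ring Q"
proof (rule vectorspace_class_ringI[OF abelian_group_quotient])
  show "c \<odot>\<^bsub>Q\<^esub> X \<in> carrier Q" if "X \<in> carrier Q" for c X
    using that by (elim carrier_Q_cases) (simp add: Q_smult coset_mem smult_simps)
  show "(c + d) \<odot>\<^bsub>Q\<^esub> X = c \<odot>\<^bsub>Q\<^esub> X \<oplus>\<^bsub>Q\<^esub> d \<odot>\<^bsub>Q\<^esub> X" if "X \<in> carrier Q" for c d X
    using that by (elim carrier_Q_cases) (simp add: Q_smult Q_add smult_simps)
  show "c \<odot>\<^bsub>Q\<^esub> (X \<oplus>\<^bsub>Q\<^esub> Y) = c \<odot>\<^bsub>Q\<^esub> X \<oplus>\<^bsub>Q\<^esub> c \<odot>\<^bsub>Q\<^esub> Y"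
    if "X \<in> carrier Q" "Y \<in> carrier Q" for c X Y
    using that by (elim carrier_Q_cases) (simp add: Q_smult Q_add smult_simps)
  show "(c * d) \<odot>\<^bsub>Q\<^esub> X = c \<odot>\<^bsub>Q\<^esub> (d \<odot>\<^bsub>Q\<^esub> X)" if "X \<in> carrier Q" for c d X
    using that by (elim carrier_Q_cases) (simp add: Q_smult smult_simps)
  show "1 \<odot>\<^bsub>Q\<^esub> X = X" if "X \<in> carrier Q" for X
    using that by (elim carrier_Q_cases) (simp add: Q_smult smult_simps)
qed

lemma quotient_one_dimensional:
  assumes t: "t \<in> carrier V" "t \<notin> B"
    and gen: "\<And>x. x \<in> carrier V \<Longrightarrow> \<exists>b\<in>B. \<exists>c. x = b \<oplus>\<^bsub>V\<^esub> c \<odot>\<^bsub>V\<^esub> t"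
  shows "vectorspace.fin_dim class_ring Q" "vectorspace.dim class_ring Q = 1"
    "LinearCombinations.module.span class_ring Q {B +>\<^bsub>V\<^esub> t} = carrier Q"
proof -
  interpret Q: vectorspace class_ring Q
    by (rule vectorspace_quotient)
  have tQ: "B +>\<^bsub>V\<^esub> t \<in> carrier Q"
    using t by (simp add: coset_mem)
  have "X \<in> Q.span {B +>\<^bsub>V\<^esub> t}" if X: "X \<in> carrier Q" for X
  proof -
    obtain x where x: "x \<in> carrier V" "X = B +>\<^bsub>V\<^esub> x"
      using X by (elim carrier_Q_cases)
    then obtain b c where "b \<in> B" "x = b \<oplus>\<^bsub>V\<^esub> c \<odot>\<^bsub>V\<^esub> t"
      using gen by blast
    hence "X = c \<odot>\<^bsub>Q\<^esub> (B +>\<^bsub>V\<^esub> t)"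
      using x t by (simp add: coset_add_left smult_simps Q_smult)
    hence "X = Q.lincomb (\<lambda>_. c) {B +>\<^bsub>V\<^esub> t}"
      using tQ Q.smult_closed[of c "B +>\<^bsub>V\<^esub> t"] by (simp add: Q.lincomb_def)
    thus ?thesis
      using Q.finite_span[of "{B +>\<^bsub>V\<^esub> t}"] tQ by auto
  qed
  moreover have "Q.span {B +>\<^bsub>V\<^esub> t} \<subseteq> carrier Q"
    using tQ by (intro Q.span_is_subset2) simp
  ultimately show span: "Q.span {B +>\<^bsub>V\<^esub> t} = carrier Q"
    by blast
  have "B +>\<^bsub>V\<^esub> t \<noteq> \<zero>\<^bsub>Q\<^esub>"
    unfolding Q_simps(2) using t by (simp only: coset_eq_B_iff not_False_eq_True)
  thus "Q.dim = 1"
    using span tQ by (intro Q.dim1I) simp_all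
  show "Q.fin_dim"
    unfolding Q.fin_dim_def using span tQ by (intro exI[of _ "{B +>\<^bsub>V\<^esub> t}"]) simp
qed

end

section \<open>Cohomology as a quotient space\<close>

text \<open>
  Subtraction in a module record is addition of an element defined by a description, so that linear maps have
  to be shown to respect it.
\<close>

lemma module_hom_minus:
  assumes M: "vectorspace class_ring M" and N: "vectorspace class_ring N"
    and f: "f \<in> LinearCombinations.module_hom class_ring M N"
    and x: "x \<in> carrier M" and y: "y \<in> carrier M"
  shows "f (x \<ominus>\<^bsub>M\<^esub> y) = f x \<ominus>\<^bsub>N\<^esub> f y"
proof -
  interpret M: vectorspace class_ring M by (rule M)
  interpret N: vectorspace class_ring N by (rule N)
  have closed: "f z \<in> carrier N" if "z \<in> carrier M" for z
    using LinearCombinations.module_hom_closed[OF f] that by auto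
  have "(x \<ominus>\<^bsub>M\<^esub> y) \<oplus>\<^bsub>M\<^esub> y = x"
    using x y by (simp add: a_minus_def M.a_assoc M.l_neg)
  hence "f x = f (x \<ominus>\<^bsub>M\<^esub> y) \<oplus>\<^bsub>N\<^esub> f y"
    using LinearCombinations.module_hom_add[OF f, of "x \<ominus>\<^bsub>M\<^esub> y" y] x y by simp
  thus ?thesis
    using x y closed[of x] closed[of y] closed[of "x \<ominus>\<^bsub>M\<^esub> y"]
    by (simp add: a_minus_def N.a_assoc N.r_neg)
qed

lemma linear_form_iff:
  "f \<in> LinearCombinations.module_hom class_ring A field_module \<longleftrightarrow>
     (\<forall>x\<in>carrier A. \<forall>y\<in>carrier A. f (x \<oplus>\<^bsub>A\<^esub> y) = f x + f y) \<and>
     (\<forall>c. \<forall>x\<in>carrier A. f (c \<odot>\<^bsub>A\<^esub> x) = c * f x)"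
  by (auto simp: LinearCombinations.module_hom_def field_module_def)

lemma linear_form_minus:
  assumes A: "vectorspace class_ring A"
    and f: "f \<in> LinearCombinations.module_hom class_ring A field_module"
    and x: "x \<in> carrier A" and y: "y \<in> carrier A"
  shows "f (x \<ominus>\<^bsub>A\<^esub> y) = f x - f y"
proof -
  interpret A: vectorspace class_ring A by (rule A)
  have "(x \<ominus>\<^bsub>A\<^esub> y) \<oplus>\<^bsub>A\<^esub> y = x"
    using x y by (simp add: a_minus_def A.a_assoc A.l_neg)
  moreover have "f ((x \<ominus>\<^bsub>A\<^esub> y) \<oplus>\<^bsub>A\<^esub> y) = f (x \<ominus>\<^bsub>A\<^esub> y) + f y"
    using f x y unfolding linear_form_iff by (metis A.minus_closed)
  ultimately show ?thesis by simp
qed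

lemma nonassoc_algebraD:
  assumes "nonassoc_algebra A"
  shows "vectorspace class_ring A"
    and "a \<in> carrier A \<Longrightarrow> b \<in> carrier A \<Longrightarrow> a \<otimes>\<^bsub>A\<^esub> b \<in> carrier A"
    and "a \<in> carrier A \<Longrightarrow> (\<lambda>b. a \<otimes>\<^bsub>A\<^esub> b) \<in> LinearCombinations.module_hom class_ring A A"
    and "b \<in> carrier A \<Longrightarrow> (\<lambda>a. a \<otimes>\<^bsub>A\<^esub> b) \<in> LinearCombinations.module_hom class_ring A A"
  using assms unfolding nonassoc_algebra_def by (auto simp: LinearCombinations.module_hom_def)

lemma nonassoc_algebra_distrib:
  assumes "nonassoc_algebra A" "a \<in> carrier A" "b \<in> carrier A" "c \<in> carrier A"
  shows "a \<otimes>\<^bsub>A\<^esub> (b \<oplus>\<^bsub>A\<^esub> c) = a \<otimes>\<^bsub>A\<^esub> b \<oplus>\<^bsub>A\<^esub> a \<otimes>\<^bsub>A\<^esub> c"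
    and "(a \<oplus>\<^bsub>A\<^esub> b) \<otimes>\<^bsub>A\<^esub> c = a \<otimes>\<^bsub>A\<^esub> c \<oplus>\<^bsub>A\<^esub> b \<otimes>\<^bsub>A\<^esub> c"
    and "a \<otimes>\<^bsub>A\<^esub> (t \<odot>\<^bsub>A\<^esub> b) = t \<odot>\<^bsub>A\<^esub> (a \<otimes>\<^bsub>A\<^esub> b)"
    and "(t \<odot>\<^bsub>A\<^esub> a) \<otimes>\<^bsub>A\<^esub> b = t \<odot>\<^bsub>A\<^esub> (a \<otimes>\<^bsub>A\<^esub> b)"
  using nonassoc_algebraD(3,4)[OF assms(1)] assms(2-) unfolding LinearCombinations.module_hom_def by auto

text \<open>
  Additive inverses are the multiples by \<open>-1\<close>, so closure under the linear operations is all that a set of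
  forms has to satisfy.
\<close>

lemma vectorspace_forms:
  assumes "(\<lambda>a b. 0) \<in> Z"
    and "\<And>\<psi> \<phi>. \<psi> \<in> Z \<Longrightarrow> \<phi> \<in> Z \<Longrightarrow> (\<lambda>a b. \<psi> a b + \<phi> a b) \<in> Z"
    and "\<And>c \<psi>. \<psi> \<in> Z \<Longrightarrow> (\<lambda>a b. c * \<psi> a b) \<in> Z"
  shows "vectorspace class_ring (bilinear_forms A\<lparr>carrier := Z\<rparr>)"
proof (rule vectorspace_class_ringI)
  show "abelian_group (bilinear_forms A\<lparr>carrier := Z\<rparr>)"
  proof (rule abelian_groupI)
    fix \<psi> assume "\<psi> \<in> carrier (bilinear_forms A\<lparr>carrier := Z\<rparr>)"
    thus "\<exists>\<phi>\<in>carrier (bilinear_forms A\<lparr>carrier := Z\<rparr>).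
            \<phi> \<oplus>\<^bsub>bilinear_forms A\<lparr>carrier := Z\<rparr>\<^esub> \<psi> = \<zero>\<^bsub>bilinear_forms A\<lparr>carrier := Z\<rparr>\<^esub>"
      using assms(3)[of \<psi> "- 1"]
      by (intro bexI[of _ "\<lambda>a b. - 1 * \<psi> a b"]) (simp_all add: bilinear_forms_def)
  qed (use assms in \<open>simp_all add: bilinear_forms_def add_ac\<close>)
qed (use assms in \<open>simp_all add: bilinear_forms_def algebra_simps\<close>)

lemma bilinear_forms_iff:
  "\<psi> \<in> carrier (bilinear_forms A) \<longleftrightarrow>
     (\<forall>a\<in>carrier A. (\<lambda>b. \<psi> a b) \<in> LinearCombinations.module_hom class_ring A field_module) \<and>
     (\<forall>b\<in>carrier A. (\<lambda>a. \<psi> a b) \<in> LinearCombinations.module_hom class_ring A field_module) \<and>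
     (\<forall>a b. a \<notin> carrier A \<or> b \<notin> carrier A \<longrightarrow> \<psi> a b = 0)"
  by (simp add: bilinear_forms_def)

lemma bilinear_forms_closed:
  "(\<lambda>a b. 0) \<in> carrier (bilinear_forms A)"
  "\<psi> \<in> carrier (bilinear_forms A) \<Longrightarrow> \<phi> \<in> carrier (bilinear_forms A) \<Longrightarrow>
     (\<lambda>a b. \<psi> a b + \<phi> a b) \<in> carrier (bilinear_forms A)"
  "\<psi> \<in> carrier (bilinear_forms A) \<Longrightarrow> (\<lambda>a b. c * \<psi> a b) \<in> carrier (bilinear_forms A)"
  by (simp_all add: bilinear_forms_iff linear_form_iff algebra_simps)

lemma Z2_rsym_closed:
  "(\<lambda>a b. 0) \<in> Z2_rsym A"
  "\<psi> \<in> Z2_rsym A \<Longrightarrow> \<phi> \<in> Z2_rsym A \<Longrightarrow> (\<lambda>a b. \<psi> a b + \<phi> a b) \<in> Z2_rsym A"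
  "\<psi> \<in> Z2_rsym A \<Longrightarrow> (\<lambda>a b. c * \<psi> a b) \<in> Z2_rsym A"
proof -
  show "(\<lambda>a b. 0) \<in> Z2_rsym A"
    by (simp add: Z2_rsym_def bilinear_forms_closed)
  show "(\<lambda>a b. \<psi> a b + \<phi> a b) \<in> Z2_rsym A" if Z2: "\<psi> \<in> Z2_rsym A" "\<phi> \<in> Z2_rsym A"
    unfolding Z2_rsym_def
  proof (intro CollectI conjI ballI)
    fix a b c assume abc: "a \<in> carrier A" "b \<in> carrier A" "c \<in> carrier A"
    have "- (\<psi> (a \<otimes>\<^bsub>A\<^esub> b) c + \<phi> (a \<otimes>\<^bsub>A\<^esub> b) c) + (\<psi> (a \<otimes>\<^bsub>A\<^esub> c) b + \<phi> (a \<otimes>\<^bsub>A\<^esub> c) b)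
        + (\<psi> a (commutator A b c) + \<phi> a (commutator A b c)) =
      (- \<psi> (a \<otimes>\<^bsub>A\<^esub> b) c + \<psi> (a \<otimes>\<^bsub>A\<^esub> c) b + \<psi> a (commutator A b c)) +
      (- \<phi> (a \<otimes>\<^bsub>A\<^esub> b) c + \<phi> (a \<otimes>\<^bsub>A\<^esub> c) b + \<phi> a (commutator A b c))"
      by (simp add: algebra_simps)
    also have "\<dots> = 0 + 0"
      using Z2 abc unfolding Z2_rsym_def by (intro arg_cong2[of _ _ _ _ "(+)"]) blast+
    finally show "- (\<psi> (a \<otimes>\<^bsub>A\<^esub> b) c + \<phi> (a \<otimes>\<^bsub>A\<^esub> b) c) + (\<psi> (a \<otimes>\<^bsub>A\<^esub> c) b + \<phi> (a \<otimes>\<^bsub>A\<^esub> c) b)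
        + (\<psi> a (commutator A b c) + \<phi> a (commutator A b c)) = 0"
      by simp
  qed (use Z2 in \<open>simp add: Z2_rsym_def bilinear_forms_closed\<close>)
  show "(\<lambda>a b. t * \<psi> a b) \<in> Z2_rsym A" if Z2: "\<psi> \<in> Z2_rsym A" for t
    unfolding Z2_rsym_def
  proof (intro CollectI conjI ballI)
    fix a b c assume abc: "a \<in> carrier A" "b \<in> carrier A" "c \<in> carrier A"
    have "- (t * \<psi> (a \<otimes>\<^bsub>A\<^esub> b) c) + t * \<psi> (a \<otimes>\<^bsub>A\<^esub> c) b + t * \<psi> a (commutator A b c) =
      t * (- \<psi> (a \<otimes>\<^bsub>A\<^esub> b) c + \<psi> (a \<otimes>\<^bsub>A\<^esub> c) b + \<psi> a (commutator A b c))"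
      by (simp add: algebra_simps)
    also have "\<dots> = t * 0"
      using Z2 abc unfolding Z2_rsym_def by (intro arg_cong[of _ _ "(*) t"]) blast
    finally show "- (t * \<psi> (a \<otimes>\<^bsub>A\<^esub> b) c) + t * \<psi> (a \<otimes>\<^bsub>A\<^esub> c) b + t * \<psi> a (commutator A b c) = 0"
      by simp
  qed (use Z2 in \<open>simp add: Z2_rsym_def bilinear_forms_closed\<close>)
qed

lemma Z2_nov_closed:
  "(\<lambda>a b. 0) \<in> Z2_nov A"
  "\<psi> \<in> Z2_nov A \<Longrightarrow> \<phi> \<in> Z2_nov A \<Longrightarrow> (\<lambda>a b. \<psi> a b + \<phi> a b) \<in> Z2_nov A"
  "\<psi> \<in> Z2_nov A \<Longrightarrow> (\<lambda>a b. c * \<psi> a b) \<in> Z2_nov A"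
  by (simp_all add: Z2_nov_def Z2_rsym_closed)

definition coboundary :: "('k::field, 'a) module \<Rightarrow> ('a \<Rightarrow> 'k) \<Rightarrow> 'a \<Rightarrow> 'a \<Rightarrow> 'k" where
  "coboundary A \<omega> = (\<lambda>a b. if a \<in> carrier A \<and> b \<in> carrier A then - \<omega> (a \<otimes>\<^bsub>A\<^esub> b) else 0)"

lemma B2_eq: "B2 A = coboundary A ` LinearCombinations.module_hom class_ring A field_module"
  by (auto simp: B2_def coboundary_def)

lemma B2_closed:
  "(\<lambda>a b. 0) \<in> B2 A"
  "\<psi> \<in> B2 A \<Longrightarrow> \<phi> \<in> B2 A \<Longrightarrow> (\<lambda>a b. \<psi> a b + \<phi> a b) \<in> B2 A"
  "\<psi> \<in> B2 A \<Longrightarrow> (\<lambda>a b. c * \<psi> a b) \<in> B2 A"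
proof -
  show "(\<lambda>a b. 0) \<in> B2 A"
    unfolding B2_eq
    by (rule image_eqI[of _ _ "\<lambda>x. 0"]) (simp_all add: coboundary_def fun_eq_iff linear_form_iff)
  show "(\<lambda>a b. \<psi> a b + \<phi> a b) \<in> B2 A" if B2: "\<psi> \<in> B2 A" "\<phi> \<in> B2 A"
  proof -
    obtain \<omega> \<omega>' where "\<psi> = coboundary A \<omega>" "\<phi> = coboundary A \<omega>'"
      "\<omega> \<in> LinearCombinations.module_hom class_ring A field_module"
      "\<omega>' \<in> LinearCombinations.module_hom class_ring A field_module"
      using B2 by (auto simp: B2_eq)
    thus ?thesis
      unfolding B2_eq
      by (intro image_eqI[of _ _ "\<lambda>x. \<omega> x + \<omega>' x"])
        (simp_all add: coboundary_def fun_eq_iff linear_form_iff algebra_simps)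
  qed
  show "(\<lambda>a b. c * \<psi> a b) \<in> B2 A" if B2: "\<psi> \<in> B2 A"
  proof -
    obtain \<omega> where "\<psi> = coboundary A \<omega>"
      "\<omega> \<in> LinearCombinations.module_hom class_ring A field_module"
      using B2 by (auto simp: B2_eq)
    thus ?thesis
      unfolding B2_eq
      by (intro image_eqI[of _ _ "\<lambda>x. c * \<omega> x"])
        (simp_all add: coboundary_def fun_eq_iff linear_form_iff algebra_simps)
  qed
qed

lemma coboundary_bilinear:
  assumes A: "nonassoc_algebra A" and \<omega>: "\<omega> \<in> LinearCombinations.module_hom class_ring A field_module"
  shows "coboundary A \<omega> \<in> carrier (bilinear_forms A)"
proof -
  interpret A: vectorspace class_ring A
    by (rule nonassoc_algebraD(1)[OF A])
  have "c \<odot>\<^bsub>A\<^esub> x \<in> carrier A" if "x \<in> carrier A" for c x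
    using A.smult_closed[of c x] that by simp
  thus ?thesis
    using \<omega> nonassoc_algebraD(2)[OF A]
    by (simp add: bilinear_forms_iff linear_form_iff coboundary_def nonassoc_algebra_distrib[OF A])
qed

text \<open>
  Applied to the right-symmetric identity, a linear form \<open>\<omega>\<close> yields the cocycle condition for the
  coboundary of \<open>\<omega>\<close>; the Novikov identity does the same in \<open>B2_subset_Z2_nov\<close>.
\<close>

lemma B2_subset_Z2_rsym:
  assumes A: "right_symmetric A"
  shows "B2 A \<subseteq> Z2_rsym A"
proof -
  have alg: "nonassoc_algebra A"
    using A by (simp add: right_symmetric_def)
  note vs = nonassoc_algebraD(1)[OF alg] and closed = nonassoc_algebraD(2)[OF alg]
  interpret A: vectorspace class_ring A
    by (rule vs)
  have "coboundary A \<omega> \<in> Z2_rsym A"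
    if \<omega>: "\<omega> \<in> LinearCombinations.module_hom class_ring A field_module" for \<omega>
  proof -
    have "\<omega> (a \<otimes>\<^bsub>A\<^esub> b \<otimes>\<^bsub>A\<^esub> c) - \<omega> (a \<otimes>\<^bsub>A\<^esub> c \<otimes>\<^bsub>A\<^esub> b) - \<omega> (a \<otimes>\<^bsub>A\<^esub> commutator A b c) = 0"
      if abc: "a \<in> carrier A" "b \<in> carrier A" "c \<in> carrier A" for a b c
    proof -
      have "a \<otimes>\<^bsub>A\<^esub> (b \<otimes>\<^bsub>A\<^esub> c) \<ominus>\<^bsub>A\<^esub> a \<otimes>\<^bsub>A\<^esub> b \<otimes>\<^bsub>A\<^esub> c =
            a \<otimes>\<^bsub>A\<^esub> (c \<otimes>\<^bsub>A\<^esub> b) \<ominus>\<^bsub>A\<^esub> a \<otimes>\<^bsub>A\<^esub> c \<otimes>\<^bsub>A\<^esub> b"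
        using A abc by (simp add: right_symmetric_def)
      hence "\<omega> (a \<otimes>\<^bsub>A\<^esub> (b \<otimes>\<^bsub>A\<^esub> c) \<ominus>\<^bsub>A\<^esub> a \<otimes>\<^bsub>A\<^esub> b \<otimes>\<^bsub>A\<^esub> c) =
             \<omega> (a \<otimes>\<^bsub>A\<^esub> (c \<otimes>\<^bsub>A\<^esub> b) \<ominus>\<^bsub>A\<^esub> a \<otimes>\<^bsub>A\<^esub> c \<otimes>\<^bsub>A\<^esub> b)"
        by simp
      hence "\<omega> (a \<otimes>\<^bsub>A\<^esub> (b \<otimes>\<^bsub>A\<^esub> c)) - \<omega> (a \<otimes>\<^bsub>A\<^esub> b \<otimes>\<^bsub>A\<^esub> c) =
             \<omega> (a \<otimes>\<^bsub>A\<^esub> (c \<otimes>\<^bsub>A\<^esub> b)) - \<omega> (a \<otimes>\<^bsub>A\<^esub> c \<otimes>\<^bsub>A\<^esub> b)"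
        using abc by (simp add: linear_form_minus[OF vs \<omega>] closed)
      moreover have "a \<otimes>\<^bsub>A\<^esub> commutator A b c =
          a \<otimes>\<^bsub>A\<^esub> (b \<otimes>\<^bsub>A\<^esub> c) \<ominus>\<^bsub>A\<^esub> a \<otimes>\<^bsub>A\<^esub> (c \<otimes>\<^bsub>A\<^esub> b)"
        unfolding commutator_def
        using module_hom_minus[OF vs vs nonassoc_algebraD(3)[OF alg abc(1)]] abc by (simp add: closed)
      ultimately show ?thesis
        using abc by (simp add: linear_form_minus[OF vs \<omega>] closed algebra_simps)
    qed
    moreover have "commutator A b c \<in> carrier A" if "b \<in> carrier A" "c \<in> carrier A" for b c
      unfolding commutator_def using that by (simp add: closed)
    ultimately show ?thesis
      unfolding Z2_rsym_def using coboundary_bilinear[OF alg \<omega>] by (simp add: coboundary_def closed)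
  qed
  thus ?thesis
    by (auto simp: B2_eq)
qed

lemma B2_subset_Z2_nov:
  assumes A: "novikov A"
  shows "B2 A \<subseteq> Z2_nov A"
proof
  fix \<psi> assume \<psi>: "\<psi> \<in> B2 A"
  have rsym: "right_symmetric A"
    using A by (simp add: novikov_def)
  then have closed: "a \<otimes>\<^bsub>A\<^esub> b \<in> carrier A" if "a \<in> carrier A" "b \<in> carrier A" for a b
    using that nonassoc_algebraD(2) by (auto simp: right_symmetric_def)
  have "\<psi> a (b \<otimes>\<^bsub>A\<^esub> c) = \<psi> b (a \<otimes>\<^bsub>A\<^esub> c)"
    if "a \<in> carrier A" "b \<in> carrier A" "c \<in> carrier A" for a b c
    using that \<psi> A by (auto simp: B2_eq coboundary_def novikov_def closed)
  thus "\<psi> \<in> Z2_nov A"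
    using B2_subset_Z2_rsym[OF rsym] \<psi> by (auto simp: Z2_nov_def)
qed

lemma linear_quotient_forms:
  assumes "B2 A \<subseteq> Z"
    and "(\<lambda>a b. 0) \<in> Z"
    and "\<And>\<psi> \<phi>. \<psi> \<in> Z \<Longrightarrow> \<phi> \<in> Z \<Longrightarrow> (\<lambda>a b. \<psi> a b + \<phi> a b) \<in> Z"
    and "\<And>c \<psi>. \<psi> \<in> Z \<Longrightarrow> (\<lambda>a b. c * \<psi> a b) \<in> Z"
  shows "linear_quotient (bilinear_forms A\<lparr>carrier := Z\<rparr>) (B2 A)"
  by (rule linear_quotient.intro[OF vectorspace_forms])
    (use assms B2_closed[where A = A] in \<open>simp_all add: bilinear_forms_def\<close>)

lemma linear_quotient_rsym:
  "right_symmetric A \<Longrightarrow> linear_quotient (bilinear_forms A\<lparr>carrier := Z2_rsym A\<rparr>) (B2 A)"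
  by (intro linear_quotient_forms B2_subset_Z2_rsym Z2_rsym_closed)

lemma linear_quotient_nov:
  "novikov A \<Longrightarrow> linear_quotient (bilinear_forms A\<lparr>carrier := Z2_nov A\<rparr>) (B2 A)"
  by (intro linear_quotient_forms B2_subset_Z2_nov Z2_nov_closed)

lemma H2_rsym_one_dimensional:
  assumes A: "right_symmetric A"
    and \<theta>: "\<theta> \<in> Z2_rsym A" "\<theta> \<notin> B2 A"
    and gen: "\<And>\<psi>. \<psi> \<in> Z2_rsym A \<Longrightarrow>
      \<exists>\<omega>\<in>LinearCombinations.module_hom class_ring A field_module. \<exists>t.
        \<psi> = (\<lambda>a b. coboundary A \<omega> a b + t * \<theta> a b)"
  shows "vectorspace.fin_dim class_ring (H2_rsym A)"
    and "vectorspace.dim class_ring (H2_rsym A) = 1"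
    and "LinearCombinations.module.span class_ring (H2_rsym A) {cohomology_class A \<theta>} =
           carrier (H2_rsym A)"
proof -
  interpret linear_quotient "bilinear_forms A\<lparr>carrier := Z2_rsym A\<rparr>" "B2 A"
    by (rule linear_quotient_rsym[OF A])
  have "\<exists>\<beta>\<in>B2 A. \<exists>t. \<psi> = \<beta> \<oplus>\<^bsub>bilinear_forms A\<^esub> (t \<odot>\<^bsub>bilinear_forms A\<^esub> \<theta>)"
    if "\<psi> \<in> Z2_rsym A" for \<psi>
    using gen[OF that] by (auto simp: B2_eq bilinear_forms_def)
  note one_dim = quotient_one_dimensional[of \<theta>, simplified, OF \<theta> this]
  have "cohomology_class A \<theta> = B2 A +>\<^bsub>bilinear_forms A\<lparr>carrier := Z2_rsym A\<rparr>\<^esub> \<theta>"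
    by (simp add: cohomology_class_def a_r_coset_def')
  thus "vectorspace.fin_dim class_ring (H2_rsym A)"
    "vectorspace.dim class_ring (H2_rsym A) = 1"
    "LinearCombinations.module.span class_ring (H2_rsym A) {cohomology_class A \<theta>} =
       carrier (H2_rsym A)"
    unfolding H2_rsym_def using one_dim by simp_all
qed

section \<open>Novikov algebras with a left unit\<close>

text \<open>
  The Novikov condition with \<open>u\<close> in second place reads \<open>\<psi>(a, b) = \<psi>(a, u \<circ> b) = \<psi>(u, a \<circ> b)\<close>, which exhibits
  \<open>\<psi>\<close> as the coboundary of \<open>- \<psi>(u, \<cdot>)\<close>.
\<close>

lemma Z2_nov_eq_B2:
  assumes A: "novikov A" and u: "u \<in> carrier A" "\<And>a. a \<in> carrier A \<Longrightarrow> u \<otimes>\<^bsub>A\<^esub> a = a"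
  shows "Z2_nov A = B2 A"
proof
  show "Z2_nov A \<subseteq> B2 A"
  proof
    fix \<psi> assume \<psi>: "\<psi> \<in> Z2_nov A"
    hence bil: "\<psi> \<in> carrier (bilinear_forms A)"
      by (simp add: Z2_nov_def Z2_rsym_def)
    have "\<psi> a b = \<psi> u (a \<otimes>\<^bsub>A\<^esub> b)" if "a \<in> carrier A" "b \<in> carrier A" for a b
    proof -
      have "\<psi> a (u \<otimes>\<^bsub>A\<^esub> b) = \<psi> u (a \<otimes>\<^bsub>A\<^esub> b)"
        using \<psi> u(1) that by (simp add: Z2_nov_def)
      thus ?thesis
        using u(2) that by simp
    qed
    hence "\<psi> = coboundary A (\<lambda>x. - \<psi> u x)"
      using bil by (auto simp: coboundary_def fun_eq_iff bilinear_forms_iff)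
    moreover have "(\<lambda>x. - \<psi> u x) \<in> LinearCombinations.module_hom class_ring A field_module"
      using bil u(1) by (simp add: bilinear_forms_iff linear_form_iff)
    ultimately show "\<psi> \<in> B2 A"
      by (auto simp: B2_eq)
  qed
qed (rule B2_subset_Z2_nov[OF A])

lemma H2_nov_trivial:
  assumes A: "novikov A" and u: "u \<in> carrier A" "\<And>a. a \<in> carrier A \<Longrightarrow> u \<otimes>\<^bsub>A\<^esub> a = a"
  shows "carrier (H2_nov A) = {\<zero>\<^bsub>H2_nov A\<^esub>}"
proof -
  interpret linear_quotient "bilinear_forms A\<lparr>carrier := Z2_nov A\<rparr>" "B2 A"
    by (rule linear_quotient_nov[OF A])
  have "carrier (H2_nov A) = {B2 A}"
    unfolding H2_nov_def Q_simps
    using coset_eq_B_iff zero_mem by (auto simp: Z2_nov_eq_B2[OF A u])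
  thus ?thesis
    by (simp add: H2_nov_def Q_simps)
qed

text \<open>
  Write \<open>U\<close> for a lift of \<open>u\<close> and \<open>\<sigma>(a)\<close> for \<open>U\<close> times any lift of \<open>a\<close>. If \<open>a'\<close> and \<open>b'\<close> are lifts of \<open>a\<close> and \<open>b\<close>,
  then \<open>\<sigma>(a) \<circ> \<sigma>(b) = \<sigma>(a) \<circ> (U \<circ> b') = U \<circ> (\<sigma>(a) \<circ> b')\<close> by the Novikov identity, and \<open>\<sigma>(a) \<circ> b'\<close> lifts
  \<open>a \<circ> b\<close>. Hence the last product is \<open>\<sigma>(a \<circ> b)\<close>.
\<close>

lemma novikov_extension_splits:
  fixes A :: "('k::field, 'a) module" and E :: "('k, 'e) module"
  assumes A: "nonassoc_algebra A"
    and u: "u \<in> carrier A" "\<And>a. a \<in> carrier A \<Longrightarrow> u \<otimes>\<^bsub>A\<^esub> a = a"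
    and ext: "novikov_central_extension A E \<iota> \<pi>"
  shows "split_extension A E \<pi>"
proof -
  have nov: "novikov E" and surj: "\<pi> ` carrier E = carrier A"
    and ker: "range \<iota> = {x \<in> carrier E. \<pi> x = \<zero>\<^bsub>A\<^esub>}"
    and central: "\<And>t x. x \<in> carrier E \<Longrightarrow> x \<otimes>\<^bsub>E\<^esub> \<iota> t = \<zero>\<^bsub>E\<^esub>"
    and \<pi>_hom: "\<pi> \<in> LinearCombinations.module_hom class_ring E A"
    and \<pi>_mult: "\<And>x y. x \<in> carrier E \<Longrightarrow> y \<in> carrier E \<Longrightarrow> \<pi> (x \<otimes>\<^bsub>E\<^esub> y) = \<pi> x \<otimes>\<^bsub>A\<^esub> \<pi> y"
    using ext by (simp_all add: novikov_central_extension_def alg_hom_def)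
  have E: "nonassoc_algebra E"
    using nov by (simp add: novikov_def right_symmetric_def)
  note vsE = nonassoc_algebraD(1)[OF E] and closed = nonassoc_algebraD(2)[OF E]
  note vsA = nonassoc_algebraD(1)[OF A]
  interpret E: vectorspace class_ring E by (rule vsE)
  interpret A: vectorspace class_ring A by (rule vsA)
  obtain U where U: "U \<in> carrier E" "\<pi> U = u"
    using surj u(1) by (metis imageE)
  define lift where "lift a = (SOME x. x \<in> carrier E \<and> \<pi> x = a)" for a
  have lift: "lift a \<in> carrier E" "\<pi> (lift a) = a" if "a \<in> carrier A" for a
  proof -
    have "\<exists>x. x \<in> carrier E \<and> \<pi> x = a"
      using surj that by (metis imageE)
    from someI_ex[OF this] show "lift a \<in> carrier E" "\<pi> (lift a) = a"
      by (simp_all add: lift_def)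
  qed
  define \<sigma> where "\<sigma> a = U \<otimes>\<^bsub>E\<^esub> lift a" for a
  \<comment> \<open>Two lifts differ by a central element, which \<open>U\<close> annihilates.\<close>
  have \<sigma>_eq: "\<sigma> (\<pi> x) = U \<otimes>\<^bsub>E\<^esub> x" if x: "x \<in> carrier E" for x
  proof -
    define y where "y = lift (\<pi> x)"
    have y: "y \<in> carrier E" "\<pi> y = \<pi> x"
      using lift surj x by (auto simp: y_def)
    have \<pi>x: "\<pi> x \<in> carrier A"
      using surj x by auto
    have "\<pi> (y \<ominus>\<^bsub>E\<^esub> x) = \<zero>\<^bsub>A\<^esub>"
      using module_hom_minus[OF vsE vsA \<pi>_hom y(1) x] y \<pi>x by (simp add: a_minus_def A.r_neg)
    hence "y \<ominus>\<^bsub>E\<^esub> x \<in> range \<iota>"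
      using ker x y by simp
    hence "U \<otimes>\<^bsub>E\<^esub> (y \<ominus>\<^bsub>E\<^esub> x) = \<zero>\<^bsub>E\<^esub>"
      using central U by auto
    hence "(U \<otimes>\<^bsub>E\<^esub> y) \<ominus>\<^bsub>E\<^esub> (U \<otimes>\<^bsub>E\<^esub> x) = \<zero>\<^bsub>E\<^esub>"
      using module_hom_minus[OF vsE vsE nonassoc_algebraD(3)[OF E U(1)] y(1) x] by simp
    thus ?thesis
      using U x y by (simp add: \<sigma>_def closed flip: y_def)
  qed
  have \<sigma>_closed: "\<sigma> a \<in> carrier E" if "a \<in> carrier A" for a
    using lift that U by (simp add: \<sigma>_def closed)
  have \<pi>\<sigma>: "\<pi> (\<sigma> a) = a" if "a \<in> carrier A" for a
    using lift that U u by (simp add: \<sigma>_def \<pi>_mult)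
  have smult_closed: "c \<odot>\<^bsub>E\<^esub> x \<in> carrier E" if "x \<in> carrier E" for c x
    using E.smult_closed[of c x] that by simp
  have "\<sigma> \<in> alg_hom A E"
    unfolding alg_hom_def LinearCombinations.module_hom_def
  proof (intro CollectI conjI allI impI ballI; (elim conjE)?)
    show "\<sigma> \<in> carrier A \<rightarrow> carrier E"
      using \<sigma>_closed by auto
  next
    fix a b assume ab: "a \<in> carrier A" "b \<in> carrier A"
    have "\<pi> (lift a \<oplus>\<^bsub>E\<^esub> lift b) = a \<oplus>\<^bsub>A\<^esub> b"
      using LinearCombinations.module_hom_add[OF \<pi>_hom] lift ab by simp
    hence "\<sigma> (a \<oplus>\<^bsub>A\<^esub> b) = U \<otimes>\<^bsub>E\<^esub> (lift a \<oplus>\<^bsub>E\<^esub> lift b)"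
      using \<sigma>_eq[of "lift a \<oplus>\<^bsub>E\<^esub> lift b"] lift ab by simp
    thus "\<sigma> (a \<oplus>\<^bsub>A\<^esub> b) = \<sigma> a \<oplus>\<^bsub>E\<^esub> \<sigma> b"
      using lift ab U by (simp add: \<sigma>_def nonassoc_algebra_distrib[OF E])
    have lifts: "lift a \<in> carrier E" "lift b \<in> carrier E"
      using lift ab by auto
    have "\<pi> (\<sigma> a \<otimes>\<^bsub>E\<^esub> lift b) = a \<otimes>\<^bsub>A\<^esub> b"
      using lift ab by (simp add: \<pi>_mult \<pi>\<sigma> \<sigma>_closed)
    hence "\<sigma> (a \<otimes>\<^bsub>A\<^esub> b) = U \<otimes>\<^bsub>E\<^esub> (\<sigma> a \<otimes>\<^bsub>E\<^esub> lift b)"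
      using \<sigma>_eq[of "\<sigma> a \<otimes>\<^bsub>E\<^esub> lift b"] lifts ab by (simp add: closed \<sigma>_closed)
    also have "\<dots> = \<sigma> a \<otimes>\<^bsub>E\<^esub> (U \<otimes>\<^bsub>E\<^esub> lift b)"
      using nov U lifts \<sigma>_closed[OF ab(1)] by (simp add: novikov_def)
    finally show "\<sigma> (a \<otimes>\<^bsub>A\<^esub> b) = \<sigma> a \<otimes>\<^bsub>E\<^esub> \<sigma> b"
      by (simp add: \<sigma>_def)
  next
    fix c :: 'k and a assume a: "a \<in> carrier A"
    have "\<pi> (c \<odot>\<^bsub>E\<^esub> lift a) = c \<odot>\<^bsub>A\<^esub> a"
      using LinearCombinations.module_hom_smult[OF \<pi>_hom, of c "lift a"] lift a by simp
    hence "\<sigma> (c \<odot>\<^bsub>A\<^esub> a) = U \<otimes>\<^bsub>E\<^esub> (c \<odot>\<^bsub>E\<^esub> lift a)"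
      using \<sigma>_eq[of "c \<odot>\<^bsub>E\<^esub> lift a"] lift a by (simp add: smult_closed)
    thus "\<sigma> (c \<odot>\<^bsub>A\<^esub> a) = c \<odot>\<^bsub>E\<^esub> \<sigma> a"
      using lift a U by (simp add: \<sigma>_def nonassoc_algebra_distrib[OF E])
  qed
  thus ?thesis
    using \<pi>\<sigma> unfolding split_extension_def by blast
qed

section \<open>Graded algebras and their cocycles\<close>

text \<open>
  The product of a graded algebra and the form with given values on the basis are both sums of this shape, with
  \<open>g\<close> taking values in the algebra and in the field respectively.
\<close>

definition bisum ::
    "(int \<Rightarrow> int \<Rightarrow> 'k::field \<Rightarrow> 'k \<Rightarrow> 'c::ab_group_add) \<Rightarrow> (int \<Rightarrow>\<^sub>0 'k) \<Rightarrow> (int \<Rightarrow>\<^sub>0 'k) \<Rightarrow> 'c" where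
  "bisum g a b = (\<Sum>i\<in>Poly_Mapping.keys a. \<Sum>j\<in>Poly_Mapping.keys b.
     g i j (Poly_Mapping.lookup a i) (Poly_Mapping.lookup b j))"

definition biadditive :: "(int \<Rightarrow> int \<Rightarrow> 'k::field \<Rightarrow> 'k \<Rightarrow> 'c::ab_group_add) \<Rightarrow> bool" where
  "biadditive g \<longleftrightarrow> (\<forall>i j x x' y. g i j (x + x') y = g i j x y + g i j x' y) \<and>
     (\<forall>i j x y y'. g i j x (y + y') = g i j x y + g i j x y')"

lemma biadditive_zero:
  assumes "biadditive g"
  shows "g i j 0 y = 0" "g i j x 0 = 0"
proof -
  have "g i j (0 + 0) y = g i j 0 y + g i j 0 y" "g i j x (0 + 0) = g i j x 0 + g i j x 0"
    using assms by (simp_all only: biadditive_def)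
  thus "g i j 0 y = 0" "g i j x 0 = 0"
    by simp_all
qed

lemma bisum_superset:
  assumes g: "biadditive g"
    and S: "finite S" "Poly_Mapping.keys a \<subseteq> S" and T: "finite T" "Poly_Mapping.keys b \<subseteq> T"
  shows "bisum g a b =
    (\<Sum>i\<in>S. \<Sum>j\<in>T. g i j (Poly_Mapping.lookup a i) (Poly_Mapping.lookup b j))"
proof -
  have "bisum g a b = (\<Sum>i\<in>Poly_Mapping.keys a. \<Sum>j\<in>T.
      g i j (Poly_Mapping.lookup a i) (Poly_Mapping.lookup b j))"
    unfolding bisum_def using T
    by (intro sum.cong refl sum.mono_neutral_left) (auto simp: in_keys_iff biadditive_zero[OF g])
  also have "\<dots> = (\<Sum>i\<in>S. \<Sum>j\<in>T. g i j (Poly_Mapping.lookup a i) (Poly_Mapping.lookup b j))"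
    using S by (intro sum.mono_neutral_left) (auto simp: in_keys_iff biadditive_zero[OF g])
  finally show ?thesis .
qed

lemma bisum_add:
  assumes g: "biadditive g"
  shows "bisum g (a + a') b = bisum g a b + bisum g a' b"
    and "bisum g a (b + b') = bisum g a b + bisum g a b'"
proof -
  let ?S = "Poly_Mapping.keys a \<union> Poly_Mapping.keys a'"
  let ?T = "Poly_Mapping.keys b \<union> Poly_Mapping.keys b'"
  have keys: "Poly_Mapping.keys (a + a') \<subseteq> ?S" "Poly_Mapping.keys (b + b') \<subseteq> ?T"
    by (rule Poly_Mapping.keys_add)+
  show "bisum g (a + a') b = bisum g a b + bisum g a' b"
    using g keys
    by (simp add: bisum_superset[OF g, of ?S _ "Poly_Mapping.keys b"] lookup_add
        sum.distrib biadditive_def)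
  show "bisum g a (b + b') = bisum g a b + bisum g a b'"
    using g keys
    by (simp add: bisum_superset[OF g, of "Poly_Mapping.keys a" _ ?T] lookup_add
        sum.distrib biadditive_def)
qed

lemma bisum_zero: "bisum g 0 b = 0" "bisum g a 0 = 0"
  by (simp_all add: bisum_def)

lemma bisum_single:
  assumes g: "biadditive g"
  shows "bisum g (Poly_Mapping.single i x) (Poly_Mapping.single j y) = g i j x y"
  by (subst bisum_superset[OF g, of "{i}" _ "{j}"]) simp_all

lemma lookup_map_zero: "h 0 = 0 \<Longrightarrow> Poly_Mapping.lookup (Poly_Mapping.map h a) k = h (Poly_Mapping.lookup a k)"
  by transfer (auto simp: when_def)

lemma keys_scale: "Poly_Mapping.keys (Poly_Mapping.map (\<lambda>x. (c::'k::field) * x) a) \<subseteq> Poly_Mapping.keys a"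
  by (auto simp: in_keys_iff lookup_map_zero)

lemma scale_single:
  "Poly_Mapping.map (\<lambda>x. (c::'k::field) * x) (Poly_Mapping.single i y) = Poly_Mapping.single i (c * y)"
  by (rule poly_mapping_eqI) (auto simp: lookup_map_zero lookup_single when_def)

lemma map_zero_poly_mapping: "Poly_Mapping.map h 0 = 0"
  by transfer (simp add: fun_eq_iff)

text \<open>
  Multilinear identities reduce to basis elements by one such induction in each argument.
\<close>

lemma keys_subset_induct [consumes 1, case_names zero single add]:
  fixes a :: "int \<Rightarrow>\<^sub>0 'k::field"
  assumes a: "Poly_Mapping.keys a \<subseteq> I"
    and zero: "P 0"
    and single: "\<And>i x. i \<in> I \<Longrightarrow> P (Poly_Mapping.single i x)"
    and add: "\<And>a b. Poly_Mapping.keys a \<subseteq> I \<Longrightarrow> Poly_Mapping.keys b \<subseteq> I \<Longrightarrow> P a \<Longrightarrow> P b \<Longrightarrow> P (a + b)"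
  shows "P a"
proof -
  have "P (\<Sum>k\<in>F. Poly_Mapping.single k (Poly_Mapping.lookup a k)) \<and>
      Poly_Mapping.keys (\<Sum>k\<in>F. Poly_Mapping.single k (Poly_Mapping.lookup a k)) \<subseteq> I"
    if "finite F" "F \<subseteq> I" for F
    using that
  proof (induction F rule: finite_induct)
    case (insert k F)
    have k: "Poly_Mapping.keys (Poly_Mapping.single k (Poly_Mapping.lookup a k)) \<subseteq> I"
      using insert.prems by simp
    hence "Poly_Mapping.keys (Poly_Mapping.single k (Poly_Mapping.lookup a k) + s) \<subseteq> I"
      if "Poly_Mapping.keys s \<subseteq> I" for s
      using Poly_Mapping.keys_add[of "Poly_Mapping.single k (Poly_Mapping.lookup a k)" s] that by blast
    thus ?case
      using insert k by (simp add: add single)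
  qed (simp add: zero)
  moreover have "(\<Sum>k\<in>Poly_Mapping.keys a. Poly_Mapping.single k (Poly_Mapping.lookup a k)) = a"
  proof (rule poly_mapping_eqI)
    fix k
    have "(\<Sum>i\<in>Poly_Mapping.keys a. Poly_Mapping.lookup a i when i = k) = Poly_Mapping.lookup a k"
      by (auto simp: when_def sum.delta in_keys_iff)
    thus "Poly_Mapping.lookup (\<Sum>k\<in>Poly_Mapping.keys a. Poly_Mapping.single k (Poly_Mapping.lookup a k)) k =
        Poly_Mapping.lookup a k"
      by (simp add: lookup_sum lookup_single)
  qed
  ultimately show ?thesis
    using a by (metis finite_keys)
qed

lemma graded_algebra_simps:
  "carrier (graded_algebra I \<gamma>) = {a. Poly_Mapping.keys a \<subseteq> I}"
  "\<zero>\<^bsub>graded_algebra I \<gamma>\<^esub> = 0"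
  "a \<oplus>\<^bsub>graded_algebra I \<gamma>\<^esub> b = a + b"
  "c \<odot>\<^bsub>graded_algebra I \<gamma>\<^esub> a = Poly_Mapping.map (\<lambda>x. c * x) a"
  by (simp_all add: graded_algebra_def)

definition basis_product ::
    "int set \<Rightarrow> (int \<Rightarrow> int \<Rightarrow> 'k::field) \<Rightarrow> int \<Rightarrow> int \<Rightarrow> 'k \<Rightarrow> 'k \<Rightarrow> int \<Rightarrow>\<^sub>0 'k" where
  "basis_product I \<gamma> i j x y = (if i + j \<in> I then Poly_Mapping.single (i + j) (\<gamma> i j * x * y) else 0)"

lemma biadditive_basis_product: "biadditive (basis_product I \<gamma>)"
  by (simp add: biadditive_def basis_product_def algebra_simps flip: single_add)

lemma biadditive_form: "biadditive (\<lambda>i j x y. x * y * f i j)"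
  by (simp add: biadditive_def algebra_simps)

lemma graded_mult_eq_bisum: "a \<otimes>\<^bsub>graded_algebra I \<gamma>\<^esub> b = bisum (basis_product I \<gamma>) a b"
  by (simp add: graded_algebra_def bisum_def basis_product_def)

lemmas graded_mult_add = bisum_add[OF biadditive_basis_product, folded graded_mult_eq_bisum]
lemmas graded_mult_zero = bisum_zero[of "basis_product _ _", folded graded_mult_eq_bisum]
lemmas graded_mult_single =
  bisum_single[OF biadditive_basis_product, folded graded_mult_eq_bisum, unfolded basis_product_def]

lemma graded_mult_scale:
  "Poly_Mapping.map (\<lambda>x. (c::'k::field) * x) a \<otimes>\<^bsub>graded_algebra I \<gamma>\<^esub> b =
     Poly_Mapping.map (\<lambda>x. c * x) (a \<otimes>\<^bsub>graded_algebra I \<gamma>\<^esub> b)"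
  "a \<otimes>\<^bsub>graded_algebra I \<gamma>\<^esub> Poly_Mapping.map (\<lambda>x. c * x) b =
     Poly_Mapping.map (\<lambda>x. c * x) (a \<otimes>\<^bsub>graded_algebra I \<gamma>\<^esub> b)"
proof -
  have scale: "(\<Sum>i\<in>S. Poly_Mapping.map (\<lambda>x. c * x) (h i)) = Poly_Mapping.map (\<lambda>x. c * x) (sum h S)"
    for S :: "int set" and h :: "int \<Rightarrow> int \<Rightarrow>\<^sub>0 'k"
    by (rule poly_mapping_eqI) (simp add: lookup_sum lookup_map_zero sum_distrib_left)
  have bp: "basis_product I \<gamma> i j (c * x) y = Poly_Mapping.map (\<lambda>x. c * x) (basis_product I \<gamma> i j x y)"
    "basis_product I \<gamma> i j x (c * y) = Poly_Mapping.map (\<lambda>x. c * x) (basis_product I \<gamma> i j x y)" for i j x y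
    by (simp_all add: basis_product_def scale_single map_zero_poly_mapping mult.left_commute mult.assoc)
  show "Poly_Mapping.map (\<lambda>x. c * x) a \<otimes>\<^bsub>graded_algebra I \<gamma>\<^esub> b =
     Poly_Mapping.map (\<lambda>x. c * x) (a \<otimes>\<^bsub>graded_algebra I \<gamma>\<^esub> b)"
    unfolding graded_mult_eq_bisum
    by (subst (1 2) bisum_superset[OF biadditive_basis_product, of "Poly_Mapping.keys a" _ "Poly_Mapping.keys b"])
      (simp_all add: keys_scale lookup_map_zero bp scale)
  show "a \<otimes>\<^bsub>graded_algebra I \<gamma>\<^esub> Poly_Mapping.map (\<lambda>x. c * x) b =
     Poly_Mapping.map (\<lambda>x. c * x) (a \<otimes>\<^bsub>graded_algebra I \<gamma>\<^esub> b)"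
    unfolding graded_mult_eq_bisum
    by (subst (1 2) bisum_superset[OF biadditive_basis_product, of "Poly_Mapping.keys a" _ "Poly_Mapping.keys b"])
      (simp_all add: keys_scale lookup_map_zero bp scale)
qed

lemma keys_graded_mult: "Poly_Mapping.keys (a \<otimes>\<^bsub>graded_algebra I \<gamma>\<^esub> b) \<subseteq> I"
proof -
  have "Poly_Mapping.keys (sum h S) \<subseteq> I" if "\<And>i. Poly_Mapping.keys (h i) \<subseteq> I"
    for h :: "int \<Rightarrow> int \<Rightarrow>\<^sub>0 'a" and S
    using Poly_Mapping.keys_sum[of h S] that by blast
  thus ?thesis
    unfolding graded_mult_eq_bisum bisum_def by (auto simp: basis_product_def)
qed

lemma nonassoc_graded_algebra: "nonassoc_algebra (graded_algebra I \<gamma>)"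
proof -
  have keys_add: "Poly_Mapping.keys (a + b) \<subseteq> I" if "Poly_Mapping.keys a \<subseteq> I" "Poly_Mapping.keys b \<subseteq> I"
    for a b :: "int \<Rightarrow>\<^sub>0 'a"
    using Poly_Mapping.keys_add[of a b] that by blast
  have "abelian_group (graded_algebra I \<gamma>)"
  proof (rule abelian_groupI)
    fix a assume "a \<in> carrier (graded_algebra I \<gamma>)"
    thus "\<exists>b\<in>carrier (graded_algebra I \<gamma>). b \<oplus>\<^bsub>graded_algebra I \<gamma>\<^esub> a = \<zero>\<^bsub>graded_algebra I \<gamma>\<^esub>"
      by (intro bexI[of _ "- a"]) (simp_all add: graded_algebra_simps keys_minus)
  qed (simp_all add: graded_algebra_simps keys_add add_ac)
  hence "vectorspace class_ring (graded_algebra I \<gamma>)"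
  proof (rule vectorspace_class_ringI)
    show "c \<odot>\<^bsub>graded_algebra I \<gamma>\<^esub> a \<in> carrier (graded_algebra I \<gamma>)"
      if "a \<in> carrier (graded_algebra I \<gamma>)" for c a
      using that keys_scale[of c a] by (auto simp: graded_algebra_simps)
  qed (auto simp: graded_algebra_simps lookup_map_zero lookup_add distrib_left distrib_right mult.assoc intro!: poly_mapping_eqI)
  thus ?thesis
    by (simp add: nonassoc_algebra_def LinearCombinations.module_hom_def graded_algebra_simps
        graded_mult_add graded_mult_scale keys_graded_mult)
qed

lemma graded_minus:
  assumes "a \<in> carrier (graded_algebra I \<gamma>)" "b \<in> carrier (graded_algebra I \<gamma>)"
  shows "a \<ominus>\<^bsub>graded_algebra I \<gamma>\<^esub> b = a - b"
proof -
  interpret A: vectorspace class_ring "graded_algebra I \<gamma>"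
    by (rule nonassoc_algebraD(1)[OF nonassoc_graded_algebra])
  have "a \<ominus>\<^bsub>graded_algebra I \<gamma>\<^esub> b \<oplus>\<^bsub>graded_algebra I \<gamma>\<^esub> b = a"
    using assms by (simp add: a_minus_def A.a_assoc A.l_neg)
  thus ?thesis
    by (simp add: graded_algebra_simps eq_diff_eq)
qed

lemma graded_commutator:
  "commutator (graded_algebra I \<gamma>) a b =
     a \<otimes>\<^bsub>graded_algebra I \<gamma>\<^esub> b - b \<otimes>\<^bsub>graded_algebra I \<gamma>\<^esub> a"
  unfolding commutator_def
  by (rule graded_minus) (simp_all add: graded_algebra_simps(1) keys_graded_mult)

text \<open>
  With the value \<open>0\<close> outside of the index set, identities among structure constants need no side
  conditions on sums of indices.
\<close>

definition structure_const :: "int set \<Rightarrow> (int \<Rightarrow> int \<Rightarrow> 'k::field) \<Rightarrow> int \<Rightarrow> int \<Rightarrow> 'k" where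
  "structure_const I \<gamma> i j = (if i + j \<in> I then \<gamma> i j else 0)"

text \<open>
  The right-symmetric and the Novikov identity for \<open>e\<^sub>i\<close>, \<open>e\<^sub>j\<close>, \<open>e\<^sub>k\<close>, read off at the coefficient of
  \<open>e\<^bsub>i+j+k\<^esub>\<close>.
\<close>

definition novikov_consts :: "int set \<Rightarrow> (int \<Rightarrow> int \<Rightarrow> 'k::field) \<Rightarrow> bool" where
  "novikov_consts I c \<longleftrightarrow> (\<forall>i\<in>I. \<forall>j\<in>I. \<forall>k\<in>I.
     c j k * c i (j + k) - c i j * c (i + j) k = c k j * c i (j + k) - c i k * c (i + k) j \<and>
     c j k * c i (j + k) = c i k * c j (i + k))"

text \<open>
  The cocycle condition for \<open>e\<^sub>i\<close>, \<open>e\<^sub>j\<close>, \<open>e\<^sub>k\<close> and a form with the values \<open>f i j\<close>. A value \<open>f i j\<close> with an index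
  outside of \<open>I\<close> is always multiplied by a vanishing structure constant when \<open>c\<close> is a \<open>structure_const I\<close>.
\<close>

definition cocycle_coeffs :: "int set \<Rightarrow> (int \<Rightarrow> int \<Rightarrow> 'k::field) \<Rightarrow> (int \<Rightarrow> int \<Rightarrow> 'k) \<Rightarrow> bool" where
  "cocycle_coeffs I c f \<longleftrightarrow> (\<forall>i\<in>I. \<forall>j\<in>I. \<forall>k\<in>I.
     - (c i j * f (i + j) k) + c i k * f (i + k) j + (c j k - c k j) * f i (j + k) = 0)"

lemma graded_mult_basis:
  "Poly_Mapping.single i x \<otimes>\<^bsub>graded_algebra I \<gamma>\<^esub> Poly_Mapping.single j y =
   Poly_Mapping.single (i + j) (structure_const I \<gamma> i j * x * y)"
  by (simp add: graded_mult_single structure_const_def)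

lemma novikov_graded_algebra:
  assumes "novikov_consts I (structure_const I \<gamma>)"
  shows "novikov (graded_algebra I \<gamma>)"
proof -
  let ?A = "graded_algebra I \<gamma>" and ?c = "structure_const I \<gamma>"
  have c: "?c j k * ?c i (j + k) - ?c i j * ?c (i + j) k = ?c k j * ?c i (j + k) - ?c i k * ?c (i + k) j"
    "?c j k * ?c i (j + k) = ?c i k * ?c j (i + k)" if "i \<in> I" "j \<in> I" "k \<in> I" for i j k
    using assms that unfolding novikov_consts_def by blast+
  have rsym: "a \<otimes>\<^bsub>?A\<^esub> (b \<otimes>\<^bsub>?A\<^esub> d) - a \<otimes>\<^bsub>?A\<^esub> b \<otimes>\<^bsub>?A\<^esub> d =
      a \<otimes>\<^bsub>?A\<^esub> (d \<otimes>\<^bsub>?A\<^esub> b) - a \<otimes>\<^bsub>?A\<^esub> d \<otimes>\<^bsub>?A\<^esub> b"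
    if "Poly_Mapping.keys a \<subseteq> I" "Poly_Mapping.keys b \<subseteq> I" "Poly_Mapping.keys d \<subseteq> I" for a b d
    using that
  proof (induction a rule: keys_subset_induct)
    case (single i x)
    from single(2,3) show ?case
    proof (induction b rule: keys_subset_induct)
      case (single j y)
      from single(2) show ?case
      proof (induction d rule: keys_subset_induct)
        case (single k z)
        have "?c i (j + k) * x * (?c j k * y * z) - ?c (i + j) k * (?c i j * x * y) * z =
            (?c j k * ?c i (j + k) - ?c i j * ?c (i + j) k) * (x * y * z)"
          by (simp add: algebra_simps)
        also have "\<dots> = (?c k j * ?c i (j + k) - ?c i k * ?c (i + k) j) * (x * y * z)"
          using c(1)[OF \<open>i \<in> I\<close> \<open>j \<in> I\<close> \<open>k \<in> I\<close>] by (simp only:)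
        also have "\<dots> = ?c i (j + k) * x * (?c k j * z * y) - ?c (i + k) j * (?c i k * x * z) * y"
          by (simp add: algebra_simps)
        finally show ?case
          by (simp add: graded_mult_basis add_ac flip: single_diff)
      qed (simp_all add: graded_mult_zero graded_mult_add algebra_simps)
    qed (simp_all add: graded_mult_zero graded_mult_add algebra_simps)
  qed (simp_all add: graded_mult_zero graded_mult_add algebra_simps)
  have nov: "a \<otimes>\<^bsub>?A\<^esub> (b \<otimes>\<^bsub>?A\<^esub> d) = b \<otimes>\<^bsub>?A\<^esub> (a \<otimes>\<^bsub>?A\<^esub> d)"
    if "Poly_Mapping.keys a \<subseteq> I" "Poly_Mapping.keys b \<subseteq> I" "Poly_Mapping.keys d \<subseteq> I" for a b d
    using that
  proof (induction a rule: keys_subset_induct)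
    case (single i x)
    from single(2,3) show ?case
    proof (induction b rule: keys_subset_induct)
      case (single j y)
      from single(2) show ?case
      proof (induction d rule: keys_subset_induct)
        case (single k z)
        show ?case
          using c(2)[OF \<open>i \<in> I\<close> \<open>j \<in> I\<close> \<open>k \<in> I\<close>] by (simp add: graded_mult_basis algebra_simps)
      qed (simp_all add: graded_mult_zero graded_mult_add)
    qed (simp_all add: graded_mult_zero graded_mult_add)
  qed (simp_all add: graded_mult_zero graded_mult_add)
  show ?thesis
    unfolding novikov_def right_symmetric_def
    using rsym nov
    by (simp add: nonassoc_graded_algebra graded_minus graded_algebra_simps(1) keys_graded_mult)
qed

lemma graded_form_eq_bisum:
  assumes "a \<in> carrier (graded_algebra I \<gamma>)" "b \<in> carrier (graded_algebra I \<gamma>)"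
  shows "graded_form I f a b = bisum (\<lambda>i j x y. x * y * f i j) a b"
  using assms by (simp add: graded_form_def bisum_def graded_algebra_simps)

lemma graded_form_bilinear: "graded_form I f \<in> carrier (bilinear_forms (graded_algebra I \<gamma>))"
proof -
  let ?g = "\<lambda>i j x y. x * y * f i j"
  have A: "nonassoc_algebra (graded_algebra I \<gamma>)"
    by (rule nonassoc_graded_algebra)
  interpret A: vectorspace class_ring "graded_algebra I \<gamma>"
    by (rule nonassoc_algebraD(1)[OF A])
  have scale: "bisum ?g (Poly_Mapping.map (\<lambda>x. t * x) a) b = t * bisum ?g a b" for t a b
    by (subst (1 2) bisum_superset[OF biadditive_form, of "Poly_Mapping.keys a" _ "Poly_Mapping.keys b"])
      (simp_all add: keys_scale lookup_map_zero sum_distrib_left mult.assoc)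
  have scale': "bisum ?g a (Poly_Mapping.map (\<lambda>x. t * x) b) = t * bisum ?g a b" for t a b
    by (subst (1 2) bisum_superset[OF biadditive_form, of "Poly_Mapping.keys a" _ "Poly_Mapping.keys b"])
      (simp_all add: keys_scale lookup_map_zero sum_distrib_left mult.left_commute mult.assoc)
  have closed: "t \<odot>\<^bsub>graded_algebra I \<gamma>\<^esub> a \<in> carrier (graded_algebra I \<gamma>)"
    if "a \<in> carrier (graded_algebra I \<gamma>)" for t a
    using A.smult_closed[of t a] that by simp
  have "graded_form I f a b = 0"
    if "a \<notin> carrier (graded_algebra I \<gamma>) \<or> b \<notin> carrier (graded_algebra I \<gamma>)" for a b
    using that by (auto simp: graded_form_def graded_algebra_simps)
  moreover have "graded_form I f a (x \<oplus>\<^bsub>graded_algebra I \<gamma>\<^esub> y) = graded_form I f a x + graded_form I f a y"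
    "graded_form I f (x \<oplus>\<^bsub>graded_algebra I \<gamma>\<^esub> y) a = graded_form I f x a + graded_form I f y a"
    if "a \<in> carrier (graded_algebra I \<gamma>)" "x \<in> carrier (graded_algebra I \<gamma>)"
      "y \<in> carrier (graded_algebra I \<gamma>)" for a x y
    unfolding graded_form_eq_bisum[OF that(1) A.a_closed[OF that(2,3)]]
      graded_form_eq_bisum[OF A.a_closed[OF that(2,3)] that(1)] graded_form_eq_bisum[OF that(1,2)]
      graded_form_eq_bisum[OF that(1,3)] graded_form_eq_bisum[OF that(2,1)] graded_form_eq_bisum[OF that(3,1)]
    by (simp_all add: graded_algebra_simps(3) bisum_add[OF biadditive_form])
  moreover have "graded_form I f a (t \<odot>\<^bsub>graded_algebra I \<gamma>\<^esub> x) = t * graded_form I f a x"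
    "graded_form I f (t \<odot>\<^bsub>graded_algebra I \<gamma>\<^esub> x) a = t * graded_form I f x a"
    if "a \<in> carrier (graded_algebra I \<gamma>)" "x \<in> carrier (graded_algebra I \<gamma>)" for t a x
    unfolding graded_form_eq_bisum[OF that(1) closed[OF that(2)]] graded_form_eq_bisum[OF that]
      graded_form_eq_bisum[OF closed[OF that(2)] that(1)] graded_form_eq_bisum[OF that(2,1)]
    by (simp_all only: graded_algebra_simps(4) scale scale')
  ultimately show ?thesis
    by (simp add: bilinear_forms_iff linear_form_iff)
qed

lemma graded_form_in_Z2_rsym:
  assumes "cocycle_coeffs I (structure_const I \<gamma>) f"
  shows "graded_form I f \<in> Z2_rsym (graded_algebra I \<gamma>)"
proof -
  let ?A = "graded_algebra I \<gamma>" and ?c = "structure_const I \<gamma>"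
  let ?g = "bisum (\<lambda>i j x y. x * y * f i j)"
  note g_simps = bisum_add[OF biadditive_form] bisum_zero bisum_single[OF biadditive_form]
  have g_minus: "?g a (b - d) = ?g a b - ?g a d" for a b d
    using bisum_add(2)[OF biadditive_form, of f a "b - d" d] by simp
  have identity: "- ?g (a \<otimes>\<^bsub>?A\<^esub> b) d + ?g (a \<otimes>\<^bsub>?A\<^esub> d) b + ?g a (b \<otimes>\<^bsub>?A\<^esub> d - d \<otimes>\<^bsub>?A\<^esub> b) = 0"
    if "Poly_Mapping.keys a \<subseteq> I" "Poly_Mapping.keys b \<subseteq> I" "Poly_Mapping.keys d \<subseteq> I" for a b d
    unfolding g_minus
    using that
  proof (induction a rule: keys_subset_induct)
    case (single i x)
    from single(2,3) show ?case
    proof (induction b rule: keys_subset_induct)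
      case (single j y)
      from single(2) show ?case
      proof (induction d rule: keys_subset_induct)
        case (single k z)
        have "- (?c i j * x * y * z * f (i + j) k) + ?c i k * x * z * y * f (i + k) j
            + (x * (?c j k * y * z) * f i (j + k) - x * (?c k j * z * y) * f i (k + j)) =
          (- (?c i j * f (i + j) k) + ?c i k * f (i + k) j + (?c j k - ?c k j) * f i (j + k)) * (x * y * z)"
          by (simp add: algebra_simps)
        also have "\<dots> = 0 * (x * y * z)"
          using assms \<open>i \<in> I\<close> \<open>j \<in> I\<close> \<open>k \<in> I\<close> unfolding cocycle_coeffs_def
          by (intro arg_cong[of _ _ "\<lambda>u. u * (x * y * z)"]) blast
        finally show ?case
          by (simp only: graded_mult_basis bisum_single[OF biadditive_form] mult_zero_left)
      next
        case (add d d')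
        thus ?case
          by (simp add: g_simps graded_mult_add) (simp add: algebra_simps)
      qed (simp add: g_simps graded_mult_zero)
    next
      case (add b b')
      thus ?case
        by (simp add: g_simps graded_mult_add) (simp add: algebra_simps)
    qed (simp add: g_simps graded_mult_zero)
  next
    case (add a a')
    thus ?case
      by (simp add: g_simps graded_mult_add) (simp add: algebra_simps)
  qed (simp add: g_simps graded_mult_zero)
  show ?thesis
    unfolding Z2_rsym_def mem_Collect_eq
  proof (intro conjI ballI)
    fix a b d assume abd: "a \<in> carrier ?A" "b \<in> carrier ?A" "d \<in> carrier ?A"
    have carr: "x \<otimes>\<^bsub>?A\<^esub> y \<in> carrier ?A" "commutator ?A x y \<in> carrier ?A"
      if "x \<in> carrier ?A" "y \<in> carrier ?A" for x y
    proof -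
      interpret A: vectorspace class_ring ?A
        by (rule nonassoc_algebraD(1)[OF nonassoc_graded_algebra])
      show "x \<otimes>\<^bsub>?A\<^esub> y \<in> carrier ?A"
        by (simp add: graded_algebra_simps keys_graded_mult)
      show "commutator ?A x y \<in> carrier ?A"
        unfolding commutator_def
        by (rule A.minus_closed) (simp_all add: graded_algebra_simps keys_graded_mult)
    qed
    have "- graded_form I f (a \<otimes>\<^bsub>?A\<^esub> b) d + graded_form I f (a \<otimes>\<^bsub>?A\<^esub> d) b
        + graded_form I f a (commutator ?A b d) =
      - ?g (a \<otimes>\<^bsub>?A\<^esub> b) d + ?g (a \<otimes>\<^bsub>?A\<^esub> d) b + ?g a (commutator ?A b d)"
      using abd carr by (simp only: graded_form_eq_bisum[where \<gamma> = \<gamma>])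
    also have "\<dots> = 0"
      using identity abd by (simp only: graded_commutator graded_algebra_simps(1) mem_Collect_eq)
    finally show "- graded_form I f (a \<otimes>\<^bsub>?A\<^esub> b) d + graded_form I f (a \<otimes>\<^bsub>?A\<^esub> d) b
        + graded_form I f a (commutator ?A b d) = 0" .
  qed (rule graded_form_bilinear)
qed

lemma bilinear_forms_eqI:
  assumes \<psi>: "\<psi> \<in> carrier (bilinear_forms (graded_algebra I \<gamma>))"
    and \<phi>: "\<phi> \<in> carrier (bilinear_forms (graded_algebra I \<gamma>))"
    and eq: "\<And>i j. i \<in> I \<Longrightarrow> j \<in> I \<Longrightarrow>
      \<psi> (Poly_Mapping.single i 1) (Poly_Mapping.single j 1) =
      \<phi> (Poly_Mapping.single i 1) (Poly_Mapping.single j 1)"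
  shows "\<psi> = \<phi>"
proof (intro ext)
  let ?A = "graded_algebra I \<gamma>"
  have zero: "\<chi> 0 b = 0" "\<chi> b 0 = 0"
    and add: "a \<in> carrier ?A \<Longrightarrow> a' \<in> carrier ?A \<Longrightarrow> \<chi> (a + a') b = \<chi> a b + \<chi> a' b"
      "a \<in> carrier ?A \<Longrightarrow> a' \<in> carrier ?A \<Longrightarrow> \<chi> b (a + a') = \<chi> b a + \<chi> b a'"
    and scale: "a \<in> carrier ?A \<Longrightarrow> \<chi> (Poly_Mapping.map (\<lambda>x. c * x) a) b = c * \<chi> a b"
      "a \<in> carrier ?A \<Longrightarrow> \<chi> b (Poly_Mapping.map (\<lambda>x. c * x) a) = c * \<chi> b a"
    if "\<chi> \<in> carrier (bilinear_forms ?A)" "b \<in> carrier ?A" for \<chi> a a' b c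
  proof -
    show add: "a \<in> carrier ?A \<Longrightarrow> a' \<in> carrier ?A \<Longrightarrow> \<chi> (a + a') b = \<chi> a b + \<chi> a' b"
      "a \<in> carrier ?A \<Longrightarrow> a' \<in> carrier ?A \<Longrightarrow> \<chi> b (a + a') = \<chi> b a + \<chi> b a'" for a a'
      using that by (simp_all add: bilinear_forms_iff linear_form_iff graded_algebra_simps(3))
    show "a \<in> carrier ?A \<Longrightarrow> \<chi> (Poly_Mapping.map (\<lambda>x. c * x) a) b = c * \<chi> a b"
      "a \<in> carrier ?A \<Longrightarrow> \<chi> b (Poly_Mapping.map (\<lambda>x. c * x) a) = c * \<chi> b a"
      using that by (simp_all add: bilinear_forms_iff linear_form_iff graded_algebra_simps(4))
    have "0 \<in> carrier ?A"
      by (simp add: graded_algebra_simps)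
    hence "\<chi> 0 b = \<chi> 0 b + \<chi> 0 b" "\<chi> b 0 = \<chi> b 0 + \<chi> b 0"
      using add[of 0 0] by (simp_all only: add_0_left)
    thus "\<chi> 0 b = 0" "\<chi> b 0 = 0"
      by (simp_all only: add_cancel_right_right)
  qed
  fix a b
  show "\<psi> a b = \<phi> a b"
  proof (cases "a \<in> carrier ?A \<and> b \<in> carrier ?A")
    case True
    hence a: "Poly_Mapping.keys a \<subseteq> I" and b: "Poly_Mapping.keys b \<subseteq> I"
      by (simp_all add: graded_algebra_simps)
    from a show ?thesis
    proof (induction a rule: keys_subset_induct)
      case (single i x)
      from b show ?case
      proof (induction b rule: keys_subset_induct)
        case (single j y)
        have mem: "Poly_Mapping.single i 1 \<in> carrier ?A" "Poly_Mapping.single j 1 \<in> carrier ?A"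
          "Poly_Mapping.single j y \<in> carrier ?A"
          using \<open>i \<in> I\<close> \<open>j \<in> I\<close> by (simp_all add: graded_algebra_simps)
        have val: "\<chi> (Poly_Mapping.single i x) (Poly_Mapping.single j y) =
            x * (y * \<chi> (Poly_Mapping.single i 1) (Poly_Mapping.single j 1))"
          if \<chi>: "\<chi> \<in> carrier (bilinear_forms ?A)" for \<chi>
          using scale(1)[OF \<chi> mem(3) mem(1), of x] scale(2)[OF \<chi> mem(1) mem(2), of y]
          by (simp add: scale_single)
        show ?case
          using val[OF \<psi>] val[OF \<phi>] eq[OF \<open>i \<in> I\<close> \<open>j \<in> I\<close>] by simp
      qed (use \<open>i \<in> I\<close> in \<open>simp_all add: zero[OF \<psi>] zero[OF \<phi>] add[OF \<psi>] add[OF \<phi>] graded_algebra_simps(1)\<close>)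
    qed (use b in \<open>simp_all add: zero[OF \<psi>] zero[OF \<phi>] add[OF \<psi>] add[OF \<phi>] graded_algebra_simps(1)\<close>)
  next
    case False
    thus ?thesis
      using \<psi> \<phi> by (auto simp: bilinear_forms_iff)
  qed
qed

lemma cocycle_coeffs_of_Z2_rsym:
  assumes \<psi>: "\<psi> \<in> Z2_rsym (graded_algebra I \<gamma>)"
  shows "cocycle_coeffs I (structure_const I \<gamma>)
    (\<lambda>i j. \<psi> (Poly_Mapping.single i 1) (Poly_Mapping.single j 1))"
  unfolding cocycle_coeffs_def
proof (intro ballI)
  let ?A = "graded_algebra I \<gamma>" and ?c = "structure_const I \<gamma>"
  define e :: "int \<Rightarrow> int \<Rightarrow>\<^sub>0 'a" where "e i = Poly_Mapping.single i 1" for i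
  have bil: "\<psi> \<in> carrier (bilinear_forms ?A)"
    using \<psi> by (simp add: Z2_rsym_def)
  fix i j k assume ijk: "i \<in> I" "j \<in> I" "k \<in> I"
  have mem: "e i \<in> carrier ?A" if "i \<in> I" for i
    using that by (simp add: e_def graded_algebra_simps)
  have prod: "e i \<otimes>\<^bsub>?A\<^esub> e j = Poly_Mapping.map (\<lambda>x. ?c i j * x) (if i + j \<in> I then e (i + j) else 0)" for i j
    by (simp add: e_def graded_mult_basis scale_single map_zero_poly_mapping structure_const_def)
  have zero_mem: "0 \<in> carrier ?A"
    by (simp add: graded_algebra_simps)
  have scale: "\<psi> (Poly_Mapping.map (\<lambda>x. c * x) a) b = c * \<psi> a b"
      "\<psi> b (Poly_Mapping.map (\<lambda>x. c * x) a) = c * \<psi> b a"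
    if "a \<in> carrier ?A" "b \<in> carrier ?A" for a b c
    using bil that by (simp_all add: bilinear_forms_iff linear_form_iff graded_algebra_simps(4))
  have left: "\<psi> (e i \<otimes>\<^bsub>?A\<^esub> e j) (e k) = ?c i j * \<psi> (e (i + j)) (e k)" if "k \<in> I" for i j k
    using that mem zero_mem
    by (simp add: prod scale) (simp add: structure_const_def)
  have right: "\<psi> (e i) (e j \<otimes>\<^bsub>?A\<^esub> e k) = ?c j k * \<psi> (e i) (e (j + k))" if "i \<in> I" for i j k
    using that mem zero_mem
    by (simp add: prod scale) (simp add: structure_const_def)
  have prod_mem: "x \<otimes>\<^bsub>?A\<^esub> y \<in> carrier ?A" for x y
    by (simp add: graded_algebra_simps keys_graded_mult)
  have "\<psi> (e i) (commutator ?A (e j) (e k)) = (?c j k - ?c k j) * \<psi> (e i) (e (j + k))"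
    unfolding commutator_def
    using linear_form_minus[OF nonassoc_algebraD(1)[OF nonassoc_graded_algebra], of "\<psi> (e i)" I \<gamma>
        "e j \<otimes>\<^bsub>?A\<^esub> e k" "e k \<otimes>\<^bsub>?A\<^esub> e j"] bil mem[OF ijk(1)] ijk
    by (simp add: bilinear_forms_iff prod_mem right add.commute algebra_simps)
  moreover have "- \<psi> (e i \<otimes>\<^bsub>?A\<^esub> e j) (e k) + \<psi> (e i \<otimes>\<^bsub>?A\<^esub> e k) (e j) + \<psi> (e i) (commutator ?A (e j) (e k)) = 0"
    using \<psi> ijk mem unfolding Z2_rsym_def by blast
  ultimately show "- (?c i j * \<psi> (Poly_Mapping.single (i + j) 1) (Poly_Mapping.single k 1))
      + ?c i k * \<psi> (Poly_Mapping.single (i + k) 1) (Poly_Mapping.single j 1)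
      + (?c j k - ?c k j) * \<psi> (Poly_Mapping.single i 1) (Poly_Mapping.single (j + k) 1) = 0"
    using ijk by (simp add: left flip: e_def)
qed

lemma coboundary_single:
  assumes \<omega>: "\<omega> \<in> LinearCombinations.module_hom class_ring (graded_algebra I \<gamma>) field_module"
    and ij: "i \<in> I" "j \<in> I"
  shows "coboundary (graded_algebra I \<gamma>) \<omega> (Poly_Mapping.single i 1) (Poly_Mapping.single j 1) =
    - structure_const I \<gamma> i j * \<omega> (Poly_Mapping.single (i + j) 1)"
proof -
  have "\<omega> (Poly_Mapping.single (i + j) (structure_const I \<gamma> i j)) =
      structure_const I \<gamma> i j * \<omega> (Poly_Mapping.single (i + j) 1)"
  proof (cases "i + j \<in> I")
    case True
    hence "Poly_Mapping.single (i + j) 1 \<in> carrier (graded_algebra I \<gamma>)"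
      by (simp add: graded_algebra_simps)
    hence "\<omega> (Poly_Mapping.map (\<lambda>x. structure_const I \<gamma> i j * x) (Poly_Mapping.single (i + j) 1)) =
        structure_const I \<gamma> i j * \<omega> (Poly_Mapping.single (i + j) 1)"
      using \<omega> unfolding linear_form_iff graded_algebra_simps(4) by blast
    thus ?thesis
      by (simp add: scale_single)
  next
    case False
    have "0 \<in> carrier (graded_algebra I \<gamma>)"
      by (simp add: graded_algebra_simps)
    hence "\<omega> (0 + 0) = \<omega> 0 + \<omega> 0"
      using \<omega> unfolding linear_form_iff graded_algebra_simps(3) by blast
    hence "\<omega> 0 = 0"
      by (simp only: add_0_left add_cancel_right_right)
    thus ?thesis
      using False by (simp add: structure_const_def)
  qed
  thus ?thesis
    using ij by (simp add: coboundary_def graded_algebra_simps(1) graded_mult_basis)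
qed

lemma linear_form_of_values:
  "(\<lambda>a. \<Sum>i\<in>Poly_Mapping.keys a. Poly_Mapping.lookup a i * w i) \<in>
     LinearCombinations.module_hom class_ring (graded_algebra I \<gamma>) field_module"
proof -
  have superset: "(\<Sum>i\<in>Poly_Mapping.keys a. Poly_Mapping.lookup a i * w i) =
      (\<Sum>i\<in>S. Poly_Mapping.lookup a i * w i)"
    if "finite S" "Poly_Mapping.keys a \<subseteq> S" for S a
    using that by (intro sum.mono_neutral_left) (auto simp: in_keys_iff)
  have "(\<Sum>i\<in>Poly_Mapping.keys (a + b). Poly_Mapping.lookup (a + b) i * w i) =
      (\<Sum>i\<in>Poly_Mapping.keys a. Poly_Mapping.lookup a i * w i) +
      (\<Sum>i\<in>Poly_Mapping.keys b. Poly_Mapping.lookup b i * w i)" for a b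
  proof -
    let ?S = "Poly_Mapping.keys a \<union> Poly_Mapping.keys b"
    have "(\<Sum>i\<in>Poly_Mapping.keys (a + b). Poly_Mapping.lookup (a + b) i * w i) =
        (\<Sum>i\<in>?S. Poly_Mapping.lookup (a + b) i * w i)"
      by (rule superset) (simp_all add: Poly_Mapping.keys_add)
    thus ?thesis
      by (simp add: superset[of ?S a] superset[of ?S b] lookup_add sum.distrib distrib_right)
  qed
  moreover have "(\<Sum>i\<in>Poly_Mapping.keys (Poly_Mapping.map (\<lambda>x. c * x) a).
        Poly_Mapping.lookup (Poly_Mapping.map (\<lambda>x. c * x) a) i * w i) =
      c * (\<Sum>i\<in>Poly_Mapping.keys a. Poly_Mapping.lookup a i * w i)" for c a
    by (subst superset[of "Poly_Mapping.keys a"])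
      (simp_all add: keys_scale lookup_map_zero sum_distrib_left mult.assoc)
  ultimately show ?thesis
    by (simp add: linear_form_iff graded_algebra_simps)
qed

text \<open>
  This reduces the computation of the cohomology to a linear system for the values on the basis: the function
  \<open>w\<close> lists the values of a linear form on the basis, and every such list is attained
  (\<open>linear_form_of_values\<close>).
\<close>

lemma H2_rsym_graded_one_dimensional:
  assumes A: "right_symmetric (graded_algebra I \<gamma>)"
    and cocycle: "cocycle_coeffs I (structure_const I \<gamma>) h"
    and nontrivial: "\<And>w. \<exists>i\<in>I. \<exists>j\<in>I. h i j \<noteq> - structure_const I \<gamma> i j * w (i + j)"
    and gen: "\<And>f. cocycle_coeffs I (structure_const I \<gamma>) f \<Longrightarrow>
      \<exists>w t. \<forall>i\<in>I. \<forall>j\<in>I. f i j = - structure_const I \<gamma> i j * w (i + j) + t * h i j"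
  shows "vectorspace.fin_dim class_ring (H2_rsym (graded_algebra I \<gamma>))"
    and "vectorspace.dim class_ring (H2_rsym (graded_algebra I \<gamma>)) = 1"
    and "LinearCombinations.module.span class_ring (H2_rsym (graded_algebra I \<gamma>))
           {cohomology_class (graded_algebra I \<gamma>) (graded_form I h)} =
         carrier (H2_rsym (graded_algebra I \<gamma>))"
proof -
  let ?A = "graded_algebra I \<gamma>"
  have mem: "graded_form I h \<in> Z2_rsym ?A"
    using cocycle by (rule graded_form_in_Z2_rsym)
  have not_mem: "graded_form I h \<notin> B2 ?A"
  proof
    assume "graded_form I h \<in> B2 ?A"
    then obtain \<omega> where \<omega>: "\<omega> \<in> LinearCombinations.module_hom class_ring ?A field_module"
      "graded_form I h = coboundary ?A \<omega>"
      by (auto simp: B2_eq)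
    have "h i j = - structure_const I \<gamma> i j * \<omega> (Poly_Mapping.single (i + j) 1)"
      if "i \<in> I" "j \<in> I" for i j
      using graded_form_basis[OF that, of h] coboundary_single[OF \<omega>(1) that] \<omega>(2) by simp
    thus False
      using nontrivial[of "\<lambda>s. \<omega> (Poly_Mapping.single s 1)"] by blast
  qed
  have "\<exists>\<omega>\<in>LinearCombinations.module_hom class_ring ?A field_module. \<exists>t.
      \<psi> = (\<lambda>a b. coboundary ?A \<omega> a b + t * graded_form I h a b)" if \<psi>: "\<psi> \<in> Z2_rsym ?A" for \<psi>
  proof -
    obtain w t where wt: "\<psi> (Poly_Mapping.single i 1) (Poly_Mapping.single j 1) =
        - structure_const I \<gamma> i j * w (i + j) + t * h i j" if "i \<in> I" "j \<in> I" for i j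
      using gen[OF cocycle_coeffs_of_Z2_rsym[OF \<psi>]] by blast
    define \<omega> where "\<omega> = (\<lambda>a. \<Sum>i\<in>Poly_Mapping.keys a. Poly_Mapping.lookup a i * w i)"
    have \<omega>: "\<omega> \<in> LinearCombinations.module_hom class_ring ?A field_module"
      unfolding \<omega>_def by (rule linear_form_of_values)
    have "\<psi> = (\<lambda>a b. coboundary ?A \<omega> a b + t * graded_form I h a b)"
    proof (rule bilinear_forms_eqI)
      show "\<psi> \<in> carrier (bilinear_forms ?A)"
        using \<psi> by (simp add: Z2_rsym_def)
      show "(\<lambda>a b. coboundary ?A \<omega> a b + t * graded_form I h a b) \<in> carrier (bilinear_forms ?A)"
        by (intro bilinear_forms_closed coboundary_bilinear nonassoc_graded_algebra \<omega> graded_form_bilinear)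
      show "\<psi> (Poly_Mapping.single i 1) (Poly_Mapping.single j 1) =
          coboundary ?A \<omega> (Poly_Mapping.single i 1) (Poly_Mapping.single j 1) +
          t * graded_form I h (Poly_Mapping.single i 1) (Poly_Mapping.single j 1)"
        if "i \<in> I" "j \<in> I" for i j
        using that by (simp add: wt coboundary_single[OF \<omega>] graded_form_basis) (simp add: \<omega>_def)
    qed
    thus ?thesis
      using \<omega> by blast
  qed
  thus "vectorspace.fin_dim class_ring (H2_rsym ?A)" "vectorspace.dim class_ring (H2_rsym ?A) = 1"
    "LinearCombinations.module.span class_ring (H2_rsym ?A) {cohomology_class ?A (graded_form I h)} =
       carrier (H2_rsym ?A)"
    using H2_rsym_one_dimensional[OF A mem not_mem] by blast+
qed

text \<open>
  Both algebras have the left unit \<open>e\<^sub>0\<close>, since \<open>e\<^sub>0 = x\<partial>\<close> acts from the left by \<open>v\<partial> \<mapsto> v \<partial>(x) \<partial>\<close>.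
\<close>

lemma graded_left_unit:
  assumes unit: "\<And>j. j \<in> I \<Longrightarrow> structure_const I \<gamma> 0 j = 1"
    and a: "a \<in> carrier (graded_algebra I \<gamma>)"
  shows "Poly_Mapping.single 0 1 \<otimes>\<^bsub>graded_algebra I \<gamma>\<^esub> a = a"
proof -
  have "Poly_Mapping.keys a \<subseteq> I"
    using a by (simp add: graded_algebra_simps)
  thus ?thesis
    by (induction a rule: keys_subset_induct)
      (simp_all add: graded_mult_zero graded_mult_add graded_mult_basis unit del: single_one)
qed

section \<open>Characteristic zero\<close>

definition W1_const :: "int \<Rightarrow> int \<Rightarrow> 'k::field" where
  "W1_const i j = of_int (i + 1)"

definition theta_coeff :: "int \<Rightarrow> int \<Rightarrow> 'k::field" where
  "theta_coeff i j = (if i + j = -1 then - of_int ((j + 1) * j) else 0)"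

lemma structure_const_UNIV: "structure_const UNIV \<gamma> = \<gamma>"
  by (simp add: structure_const_def fun_eq_iff)

lemma novikov_consts_W1: "novikov_consts UNIV (W1_const :: int \<Rightarrow> int \<Rightarrow> 'k::field)"
  by (simp add: novikov_consts_def W1_const_def algebra_simps)

text \<open>
  Substituting \<open>i = -1 - j - k\<close> turns the condition into a polynomial identity in \<open>j\<close> and \<open>k\<close>.
\<close>

lemma cocycle_coeffs_theta:
  "cocycle_coeffs UNIV W1_const (theta_coeff :: int \<Rightarrow> int \<Rightarrow> 'k::field)"
proof -
  have "- (W1_const i j * theta_coeff (i + j) k) + W1_const i k * theta_coeff (i + k) j
      + (W1_const j k - W1_const k j) * theta_coeff i (j + k) = (0 :: 'k)" for i j k
  proof (cases "i + j + k = -1")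
    case True
    hence i: "i = - 1 - j - k" by simp
    show ?thesis
      unfolding i by (simp add: W1_const_def theta_coeff_def algebra_simps)
  qed (simp add: theta_coeff_def add_ac)
  thus ?thesis
    by (simp add: cocycle_coeffs_def)
qed

lemma cocycle_coeffs_char_0:
  fixes f :: "int \<Rightarrow> int \<Rightarrow> 'k::field"
  assumes char: "CHAR('k) = 0" and f: "cocycle_coeffs UNIV W1_const f"
  shows "\<exists>w t. \<forall>i j. f i j = - W1_const i j * w (i + j) + t * theta_coeff i j"
proof -
  have of_int_0: "(of_int n :: 'k) = 0 \<longleftrightarrow> n = 0" for n
    using char by (simp add: of_int_eq_0_iff_char_dvd)
  have rel: "(of_int (i + 1) :: 'k) * (f (i + k) j - f (i + j) k) + of_int (j - k) * f i (j + k) = 0" for i j k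
  proof -
    have "- (of_int (i + 1) * f (i + j) k) + of_int (i + 1) * f (i + k) j
        + (of_int (j + 1) - of_int (k + 1)) * f i (j + k) = 0"
      using f unfolding cocycle_coeffs_def W1_const_def by blast
    thus ?thesis
      by (simp add: algebra_simps)
  qed
  \<comment> \<open>The relation with \<open>e\<^sub>0\<close> determines \<open>f\<close> in every degree except \<open>-1\<close>.\<close>
  have generic: "(of_int (i + j + 1) :: 'k) * f i j = of_int (i + 1) * f (i + j) 0" for i j
    using rel[of i 0 j] by (simp add: algebra_simps)
  define g where "g j = f (- 1 - j) j" for j
  have g_rel: "(of_int (j + k) :: 'k) * (g j - g k) = of_int (j - k) * g (j + k)" for j k
    using rel[of "- 1 - j - k" j k] by (simp add: g_def algebra_simps)
  \<comment> \<open>The constants are chosen to make the formula for \<open>g\<close> correct at \<open>j = -1\<close> and \<open>j = 1\<close>.\<close>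
  define w where "w = - g (- 1)"
  define t where "t = (w - g 1) / 2"
  have two: "(2 :: 'k) \<noteq> 0"
    using of_int_0[of 2] by simp
  have g_1: "g 1 = w - 2 * t"
    by (simp only: t_def times_divide_eq_right nonzero_mult_div_cancel_left[OF two]) simp
  have g_0: "g 0 = 0"
    using generic[of "-1" 0] rel[of "-2" 1 0] by (simp add: g_def)
  \<comment> \<open>Dividing by \<open>j\<close> in the recursion fails at \<open>j = 0\<close>, so the two half-lines start from \<open>g 1\<close> and \<open>g (-1)\<close>.\<close>
  have up: "g j = of_int j * w - t * of_int ((j + 1) * j)" if "j \<ge> 1" for j
    using that
  proof (induction j rule: int_ge_induct)
    case base
    thus ?case using g_1 by simp
  next
    case (step j)
    have "of_int j * (g (j + 1) - g (- 1)) = of_int (j + 2) * g j"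
      using g_rel[of "j + 1" "- 1"] by (simp add: add.assoc)
    hence "of_int j * g (j + 1) = of_int j * g (- 1) + of_int (j + 2) * g j"
      by (simp add: right_diff_distrib diff_eq_eq add.commute)
    also have "\<dots> = of_int j * (of_int (j + 1) * w - t * of_int ((j + 2) * (j + 1)))"
      unfolding step.IH by (simp add: w_def algebra_simps)
    finally have "of_int j * g (j + 1) = of_int j * (of_int (j + 1) * w - t * of_int ((j + 2) * (j + 1)))" .
    thus ?case
      using step.hyps of_int_0[of j] by (simp add: add.assoc)
  qed
  have down: "g j = of_int j * w - t * of_int ((j + 1) * j)" if "j \<le> -1" for j
    using that
  proof (induction j rule: int_le_induct)
    case base
    thus ?case by (simp add: w_def)
  next
    case (step j)
    have "of_int j * g (j - 1) = of_int j * (of_int (j - 1) * w - t * of_int (j * (j - 1)))"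
      using g_rel[of "j - 1" 1] by (simp add: g_1 step.IH algebra_simps)
    thus ?case
      using step.hyps of_int_0[of j] by simp
  qed
  have g: "g j = of_int j * w - t * of_int ((j + 1) * j)" for j
    using up[of j] down[of j] g_0 by (cases "j = 0"; cases "j \<ge> 1") simp_all
  have "f i j = - W1_const i j * (if i + j = -1 then w else - f (i + j) 0 / of_int (i + j + 1))
      + t * theta_coeff i j" for i j
  proof (cases "i + j = -1")
    case True
    hence i: "i = - 1 - j" by simp
    show ?thesis
      using g[of j] unfolding i by (simp add: g_def W1_const_def theta_coeff_def)
  next
    case False
    hence "(of_int (i + j + 1) :: 'k) \<noteq> 0"
      using of_int_0[of "i + j + 1"] by simp
    thus ?thesis
      using False generic[of i j] by (simp add: W1_const_def theta_coeff_def field_simps)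
  qed
  thus ?thesis
    by (intro exI[of _ "\<lambda>s. if s = -1 then w else - f s 0 / of_int (s + 1)"] exI[of _ t]) simp
qed

lemma theta_nontrivial:
  fixes w :: "int \<Rightarrow> 'k::field"
  assumes "CHAR('k) = 0"
  shows "\<exists>i j. theta_coeff i j \<noteq> - W1_const i j * w (i + j)"
proof (rule ccontr)
  assume "\<not> ?thesis"
  hence eq: "theta_coeff i j = - W1_const i j * w (i + j)" for i j
    by blast
  have "(of_int 2 :: 'k) = 0"
    using eq[of 0 "-1"] eq[of "-2" 1] by (simp add: theta_coeff_def W1_const_def)
  thus False
    using assms unfolding of_int_eq_0_iff_char_dvd by simp
qed

lemma W1_rsym_eq: "W1_rsym = graded_algebra UNIV W1_const"
  by (simp add: W1_rsym_def W1_const_def[abs_def])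

lemma theta_eq: "theta = graded_form UNIV theta_coeff"
  by (simp add: theta_def theta_coeff_def[abs_def])

section \<open>Binomial coefficients in positive characteristic\<close>

definition trinomial :: "nat \<Rightarrow> nat \<Rightarrow> nat \<Rightarrow> nat" where
  "trinomial a b d = (a + b + d choose a) * (b + d choose b)"

text \<open>
  The trinomial coefficient is \<open>(a+b+d)! / (a! b! d!)\<close>; its symmetry is the source of the algebra
  identities.
\<close>

lemma trinomial_fact: "trinomial a b d * (fact a * fact b * fact d) = fact (a + b + d)"
proof -
  have "fact a * fact (b + d) * (a + b + d choose a) = (fact (a + b + d) :: nat)"
    using binomial_fact_lemma[of a "a + b + d"] by simp
  moreover have "fact b * fact d * (b + d choose b) = (fact (b + d) :: nat)"
    using binomial_fact_lemma[of b "b + d"] by simp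
  ultimately show ?thesis
    unfolding trinomial_def by (metis (no_types, lifting) mult.assoc mult.commute)
qed

lemma trinomial_swap: "trinomial a b d = trinomial b a d" "trinomial a b d = trinomial a d b"
proof -
  have "trinomial a b d * (fact a * fact b * fact d) = trinomial b a d * (fact a * fact b * fact d)"
    using trinomial_fact[of a b d] trinomial_fact[of b a d] by (simp add: ac_simps)
  thus "trinomial a b d = trinomial b a d" by simp
  have "trinomial a b d * (fact a * fact b * fact d) = trinomial a d b * (fact a * fact b * fact d)"
    using trinomial_fact[of a b d] trinomial_fact[of a d b] by (simp add: ac_simps)
  thus "trinomial a b d = trinomial a d b" by simp
qed

lemma trinomial_alt: "(a + b choose a) * (a + b + d choose (a + b)) = trinomial a b d"
proof -
  have "(a + b choose a) * (a + b + d choose (a + b)) = trinomial d a b"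
    using binomial_symmetric[of d "a + b + d"] by (simp add: trinomial_def ac_simps)
  thus ?thesis
    using trinomial_swap by metis
qed

text \<open>
  Split the first factor by Pascal's rule. The two summands are the coefficients of \<open>e\<^sub>i \<circ> (e\<^sub>j \<circ> e\<^sub>k)\<close> and of the
  negative of the associator, when the recursion is read as an expression for \<open>(e\<^sub>i \<circ> e\<^sub>j) \<circ> e\<^sub>k\<close>.
\<close>

lemma trinomial_recursion:
  "(Suc a + b choose Suc a) * (a + b + d choose (a + b)) =
     (if b = 0 then 0 else trinomial (Suc a) (b - 1) d) + trinomial a b d"
proof (cases b)
  case 0
  thus ?thesis
    by (simp add: trinomial_def)
next
  case (Suc b')
  have "Suc a + b choose Suc a = (a + b choose Suc a) + (a + b choose a)"
    by simp
  moreover have "(a + b choose Suc a) * (a + b + d choose (a + b)) = trinomial (Suc a) b' d"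
    using trinomial_alt[of "Suc a" b' d] Suc by simp
  ultimately show ?thesis
    using trinomial_alt[of a b d] Suc by (simp add: algebra_simps)
qed

context
  fixes p m q :: nat
  assumes p: "p = CHAR('k::field)" "p > 0" and q: "q = p ^ m"
begin

text \<open>
  From \<open>a (q choose a) = q (q - 1 choose a - 1)\<close>: if \<open>p\<close> did not divide the binomial coefficient, \<open>q\<close> would divide
  \<open>a < q\<close>.
\<close>

lemma of_nat_choose_eq_0:
  assumes "0 < a" "a < q"
  shows "(of_nat (q choose a) :: 'k) = 0"
proof -
  have "prime p"
    using p prime_CHAR_semidom[where 'a = 'k] by simp
  obtain a' where a: "a = Suc a'"
    using assms by (cases a) auto
  have "a * (q choose a) = q * (q - 1 choose a')"
    using times_binomial_minus1_eq[of a q] assms a by simp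
  hence dvd: "p ^ m dvd a * (q choose a)"
    using q by simp
  have "p dvd (q choose a)"
  proof (rule ccontr)
    assume "\<not> p dvd (q choose a)"
    hence "coprime (p ^ m) (q choose a)"
      using \<open>prime p\<close> by (simp add: prime_imp_coprime)
    hence "p ^ m dvd a"
      using dvd by (simp add: coprime_dvd_mult_left_iff)
    thus False
      using assms q by (auto dest: dvd_imp_le)
  qed
  thus ?thesis
    using p by (simp add: of_nat_eq_0_iff_char_dvd)
qed

text \<open>
  Pascal's rule for \<open>q choose (a + 1)\<close>, which vanishes, makes consecutive coefficients negatives of each other.
\<close>

lemma of_nat_choose_pred: "a < q \<Longrightarrow> (of_nat (q - 1 choose a) :: 'k) = (-1) ^ a"
proof (induction a)
  case (Suc a)
  have "q choose Suc a = (q - 1 choose a) + (q - 1 choose Suc a)"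
    using Suc.prems by (cases q) simp_all
  hence "(of_nat (q - 1 choose a) :: 'k) + of_nat (q - 1 choose Suc a) = 0"
    using of_nat_choose_eq_0[of "Suc a"] Suc.prems by (simp flip: of_nat_add)
  thus ?case
    using Suc by (simp add: add_eq_0_iff)
qed simp

text \<open>
  Both \<open>(q-1 choose a) (q-1-a choose b)\<close> and \<open>(q-1 choose a+b) (a+b choose a)\<close> are the trinomial coefficient of
  \<open>q - 1\<close> with parts \<open>a\<close> and \<open>b\<close>, and the outer factors are signs.
\<close>

lemma of_nat_choose_reflect:
  assumes "a + b < q"
  shows "(of_nat (q - 1 - a choose b) :: 'k) = (-1) ^ b * of_nat (a + b choose a)"
proof -
  define d where "d = q - 1 - a - b"
  have q_eq: "q - 1 = a + b + d" "q - 1 - a = b + d"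
    using assms by (auto simp: d_def)
  have "(q - 1 choose a) * (q - 1 - a choose b) = (a + b choose a) * (q - 1 choose (a + b))"
    unfolding q_eq trinomial_alt by (simp add: trinomial_def)
  hence "(of_nat (q - 1 choose a) :: 'k) * of_nat (q - 1 - a choose b) =
      of_nat (a + b choose a) * of_nat (q - 1 choose (a + b))"
    by (metis of_nat_mult)
  hence "(-1) ^ a * of_nat (q - 1 - a choose b) = (-1) ^ a * ((-1) ^ b * (of_nat (a + b choose a) :: 'k))"
    using of_nat_choose_pred[of a] of_nat_choose_pred[of "a + b"] assms by (simp only:) (simp add: power_add mult_ac)
  thus ?thesis
    by simp
qed

lemma minus_one_power_pred: "q > 0 \<Longrightarrow> (-1 :: 'k) ^ (q - 1) = 1"
  using of_nat_choose_pred[of "q - 1"] by simp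

end

section \<open>The divided power algebra\<close>

definition divided_power_const :: "int \<Rightarrow> int \<Rightarrow> 'k::field" where
  "divided_power_const i j = (if i = -1 then 0 else of_nat (nat (i + j + 1) choose nat i))"

definition theta_trunc_coeff :: "nat \<Rightarrow> int \<Rightarrow> int \<Rightarrow> 'k::field" where
  "theta_trunc_coeff q i j = (if i + j = int q - 1 then - ((-1) powi i) else 0)"

locale truncated =
  fixes p m q :: nat and c :: "int \<Rightarrow> int \<Rightarrow> 'k::field" and I :: "int set"
  assumes p: "p = CHAR('k)" "p > 0" and m: "m \<ge> 1" and q: "q = p ^ m"
    and I: "I = {-1 .. int q - 2}" and c: "c = structure_const I divided_power_const"
begin

lemma prime_p: "prime p"
  using p prime_CHAR_semidom[where 'a = 'k] by simp

lemma q_ge: "q \<ge> p" "q \<ge> 2"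
proof -
  show "q \<ge> p"
    using q m p by (simp add: self_le_power)
  thus "q \<ge> 2"
    using prime_ge_2_nat[OF prime_p] by simp
qed

lemma of_nat_q: "(of_nat q :: 'k) = 0"
  using q p m by (simp add: of_nat_eq_0_iff_char_dvd)

lemma of_int_q: "(of_int (int q) :: 'k) = 0"
  using of_nat_q by simp

lemmas choose_eq_0 = of_nat_choose_eq_0[OF p q]
lemmas choose_reflect = of_nat_choose_reflect[OF p q]

lemma c_minus_one: "c (-1) j = 0"
  by (simp add: c structure_const_def divided_power_const_def)

lemma c_outside: "i + j \<notin> I \<Longrightarrow> c i j = 0"
  by (simp add: c structure_const_def)

text \<open>
  The right factor is indexed by its divided power: \<open>e\<^sub>j = x\<^sup>(\<^sup>b\<^sup>)\<partial>\<close> with \<open>b = j + 1\<close>, and the left factor by its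
  own index \<open>a = i\<close>, the power that remains after differentiation. In these variables the structure
  constant is a plain binomial coefficient.
\<close>

lemma c_nat: "c (int a) (int b - 1) = (if a + b < q then of_nat (a + b choose a) else 0)"
  by (auto simp: c structure_const_def divided_power_const_def I nat_add_distrib)

lemma index_cases:
  assumes "i \<in> I"
  obtains "i = -1" | a where "i = int a" "a + 2 \<le> q"
proof (cases "i = -1")
  case False
  hence "i = int (nat i)" "nat i + 2 \<le> q"
    using assms q_ge by (auto simp: I)
  thus ?thesis
    using that by blast
qed

lemma index_shift:
  assumes "i \<in> I"
  obtains b where "i = int b - 1" "b < q"
  using assms q_ge that[of "nat (i + 1)"] by (auto simp: I)

text \<open>
  The coefficient of \<open>e\<^sub>i \<circ> (e\<^sub>j \<circ> e\<^sub>k)\<close> for \<open>i = a\<close>, \<open>j = b - 1\<close>, \<open>k = d - 1\<close>. Here \<open>j\<close> is the left factor of the inner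
  product, hence the shift to \<open>b - 1\<close>.
\<close>

lemma coeff_right_nested_in_range: "a + b + d \<le> q \<Longrightarrow> 0 < b \<Longrightarrow>
    c (int b - 1) (int d - 1) * c (int a) (int b - 1 + (int d - 1)) = of_nat (trinomial a (b - 1) d)"
proof -
  assume abd: "a + b + d \<le> q" "0 < b"
  then obtain b' where b: "b = Suc b'" by (cases b) auto
  have "c (int b - 1) (int d - 1) = of_nat (b' + d choose b')"
    using c_nat[of b' d] abd b by simp
  moreover have "c (int a) (int b - 1 + (int d - 1)) = of_nat (a + (b' + d) choose a)"
    using c_nat[of a "b' + d"] abd b by (simp add: algebra_simps)
  ultimately show ?thesis
    using b by (simp add: trinomial_def mult.commute add.assoc flip: of_nat_mult)
qed

lemma coeff_right_nested: "c (int b - 1) (int d - 1) * c (int a) (int b - 1 + (int d - 1)) =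
    (if a + b + d \<le> q \<and> 0 < b then of_nat (trinomial a (b - 1) d) else 0)"
proof (cases "0 < b \<and> a + b + d \<le> q")
  case False
  hence "b = 0 \<or> c (int a) (int b - 1 + (int d - 1)) = 0"
    by (auto intro!: c_outside simp: I)
  thus ?thesis
    using False c_minus_one by auto
qed (use coeff_right_nested_in_range in simp)

text \<open>
  The coefficient of \<open>(e\<^sub>i \<circ> e\<^sub>j) \<circ> e\<^sub>k\<close>. The inner product can leave the index set while the total degree stays
  inside; this happens only for \<open>a + b = q\<close>, and then the binomial coefficient \<open>q choose a\<close> is \<open>0\<close> in the
  field, so that the formula holds without an exception.
\<close>

lemma coeff_left_nested:
  assumes "a < q" "b < q" "0 < a"
  shows "c (int a) (int b - 1) * c (int a + (int b - 1)) (int d - 1) =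
    (if a + b + d \<le> q then of_nat ((a + b choose a) * (a + b + d - 1 choose (a + b - 1))) else 0)"
proof -
  have shift: "int a + (int b - 1) = int (a + b - 1)"
    using assms by simp
  have c2: "c (int a + (int b - 1)) (int d - 1) =
      (if a + b + d \<le> q then of_nat (a + b + d - 1 choose (a + b - 1)) else 0)"
    unfolding shift c_nat using assms by auto
  show ?thesis
  proof (cases "a + b < q")
    case True
    thus ?thesis
      unfolding c2 c_nat by simp
  next
    case False
    hence "c (int a) (int b - 1) = 0"
      unfolding c_nat by simp
    moreover have "(of_nat (a + b choose a) :: 'k) = 0" if "a + b + d \<le> q"
    proof -
      have "a + b = q"
        using that False by simp
      thus ?thesis
        using choose_eq_0[of a] assms by simp
    qed
    ultimately show ?thesis by simp
  qed
qed

text \<open>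
  The result is symmetric in \<open>b\<close> and \<open>d\<close>, which is right symmetry.
\<close>

lemma c_associator:
  assumes "a < q" "b < q"
  shows "c (int b - 1) (int d - 1) * c (int a) (int b - 1 + (int d - 1)) -
      c (int a) (int b - 1) * c (int a + (int b - 1)) (int d - 1) =
    (if a = 0 \<or> a + b + d > q then 0 else - of_nat (trinomial (a - 1) b d))"
proof (cases a)
  case 0
  have "c 0 (int b - 1) * c (int b - 1) (int d - 1) =
      (if b + d \<le> q \<and> 0 < b then of_nat (trinomial 0 (b - 1) d) else 0)"
  proof (cases "b = 0")
    case False
    then obtain b' where b: "b = Suc b'" by (cases b) auto
    show ?thesis
      using c_nat[of 0 b] c_nat[of b' d] assms b by (simp add: trinomial_def)
  qed (simp add: c_minus_one)
  thus ?thesis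
    using 0 coeff_right_nested[of b d 0] by simp
next
  case (Suc a')
  hence pos: "0 < a" by simp
  show ?thesis
  proof (cases "a + b + d \<le> q")
    case True
    have "(Suc a' + b choose Suc a') * (a' + b + d choose (a' + b)) =
        (if b = 0 then 0 else trinomial (Suc a') (b - 1) d) + trinomial a' b d"
      by (rule trinomial_recursion)
    hence "(of_nat ((a + b choose a) * (a + b + d - 1 choose (a + b - 1))) :: 'k) =
        of_nat (if b = 0 then 0 else trinomial a (b - 1) d) + of_nat (trinomial (a - 1) b d)"
      unfolding of_nat_add[symmetric] Suc by simp
    thus ?thesis
      unfolding coeff_right_nested coeff_left_nested[OF assms pos] using True Suc by simp
  next
    case False
    thus ?thesis
      unfolding coeff_right_nested coeff_left_nested[OF assms pos] by simp
  qed
qed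

lemma novikov_consts_c: "novikov_consts I c"
  unfolding novikov_consts_def
proof (intro ballI)
  fix i j k assume ijk: "i \<in> I" "j \<in> I" "k \<in> I"
  obtain b where b: "j = int b - 1" "b < q"
    using index_shift[OF ijk(2)] .
  obtain d where d: "k = int d - 1" "d < q"
    using index_shift[OF ijk(3)] .
  have swap: "c j k * c i (j + k) = c i k * c j (i + k)" (is ?swap)
    using ijk(1)
  proof (cases rule: index_cases)
    case (2 a)
    from ijk(2) show ?thesis
    proof (cases rule: index_cases)
      case (2 e)
      show ?thesis
        using coeff_right_nested[of "Suc e" d a] coeff_right_nested[of "Suc a" d e] trinomial_swap(1)[of a e d]
          \<open>i = int a\<close> \<open>j = int e\<close> d by (simp add: ac_simps)
    qed (simp add: c_minus_one)
  qed (simp add: c_minus_one)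
  from ijk(1) show "c j k * c i (j + k) - c i j * c (i + j) k = c k j * c i (j + k) - c i k * c (i + k) j \<and> ?swap"
  proof (cases rule: index_cases)
    case 1
    thus ?thesis
      using swap by (simp add: c_minus_one)
  next
    case (2 a)
    thus ?thesis
      using swap c_associator[of a b d] c_associator[of a d b] b d
      by (simp add: trinomial_swap(2)[of _ b d] add_ac)
  qed
qed


section \<open>The cocycle in positive characteristic\<close>

abbreviation \<theta> :: "int \<Rightarrow> int \<Rightarrow> 'k" where "\<theta> \<equiv> theta_trunc_coeff q"

lemma zero_mem: "0 \<in> I"
  using q_ge by (simp add: I)

lemma c_zero_left: "j \<in> I \<Longrightarrow> c 0 j = 1"
proof (elim index_shift)
  fix b assume "j = int b - 1" "b < q"
  thus ?thesis using c_nat[of 0 b] by simp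
qed

lemma c_zero_right: "i \<in> I \<Longrightarrow> c i 0 = of_int (i + 1)"
proof (elim index_cases)
  fix a assume a: "i = int a" "a + 2 \<le> q"
  thus ?thesis using c_nat[of a 1] by simp
qed (simp add: c_minus_one)

lemma c_minus_one_right: "i \<in> I \<Longrightarrow> 0 \<le> i \<Longrightarrow> c i (-1) = 1"
proof (elim index_cases)
  fix a assume a: "i = int a" "a + 2 \<le> q"
  thus ?thesis using c_nat[of a 0] by simp
qed simp

text \<open>
  For \<open>i = 0\<close> the first summand is the constant with left index \<open>-1\<close>, whose value \<open>0\<close> continues Pascal's rule to
  the boundary.
\<close>

lemma c_pascal:
  assumes "i \<in> I" "j \<in> I" "0 \<le> i" "0 \<le> j" "i + j \<in> I"
  shows "c (i - 1) j + c i (j - 1) = c i j"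
  using assms(1)
proof (cases rule: index_cases)
  case (2 a)
  obtain b where b: "j = int b - 1" "b < q"
    using index_shift[OF assms(2)] .
  then obtain b' where b': "b = Suc b'"
    using assms(4) by (cases b) auto
  have lt: "a + b < q"
    using 2 b assms(5) by (simp add: I)
  have *: "c i j = of_nat (a + b choose a)" "c i (j - 1) = of_nat (a + b' choose a)"
    using c_nat[of a b] c_nat[of a b'] lt 2 b b' by simp_all
  show ?thesis
  proof (cases a)
    case 0
    thus ?thesis using * 2 by (simp add: c_minus_one)
  next
    case (Suc a')
    have "c (i - 1) j = of_nat (a' + b choose a')"
      using c_nat[of a' b] lt 2 b Suc by simp
    thus ?thesis
      unfolding * using Suc b' by (simp add: add.commute)
  qed
qed (use assms in simp)

text \<open>
  For \<open>i \<ge> 0\<close> this is the congruence \<open>of_nat_choose_reflect\<close> with \<open>a = i\<close>, \<open>b = j + 1\<close> and \<open>q - 1 - a = j + k\<close>; for \<open>i = -1\<close>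
  both sides vanish. No case distinction on \<open>i + j\<close> is left, because for \<open>i + j \<notin> I\<close> the right-hand side is
  \<open>0\<close> as well.
\<close>

lemma c_sign:
  assumes "i \<in> I" "j \<in> I" "k \<in> I" "i + j + k = int q - 1"
  shows "c i j * (-1) powi j = - of_nat (nat (j + k) choose nat (j + 1))"
  using assms(1)
proof (cases rule: index_cases)
  case 1
  hence jk: "nat (j + k) = q" "0 < nat (j + 1)" "nat (j + 1) < q"
    using assms by (auto simp: I)
  show ?thesis
    unfolding 1 c_minus_one jk(1) using choose_eq_0[OF jk(2,3)] by simp
next
  case (2 a)
  obtain b where b: "j = int b - 1" "b < q"
    using index_shift[OF assms(2)] .
  have n: "nat (j + k) = q - 1 - a" "nat (j + 1) = b"
    using 2 b assms(4) by auto
  show ?thesis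
  proof (cases "a + b < q")
    case True
    have "(-1 :: 'k) powi j = - ((-1) ^ b)"
      using power_int_diff[of "-1 :: 'k" "int b" 1] b by simp
    moreover have "((-1 :: 'k) ^ b) * of_nat (a + b choose a) = of_nat (q - 1 - a choose b)"
      using choose_reflect[OF True] by simp
    moreover have "c i j = of_nat (a + b choose a)"
      using c_nat[of a b] True 2 b by simp
    ultimately show ?thesis
      unfolding n by (simp add: mult.commute)
  next
    case False
    hence z: "q - 1 - a choose b = 0"
      using 2 by (intro binomial_eq_0) auto
    thus ?thesis
      unfolding n z using c_nat[of a b] 2 b False by simp
  qed
qed

text \<open>
  By Pascal's rule and the symmetry of binomial coefficients, for \<open>i \<ge> 1\<close>. For \<open>i = 0\<close> and \<open>i = -1\<close> the product of
  \<open>e\<^sub>j\<close> and \<open>e\<^sub>k\<close> leaves the index set, and the two binomial coefficients on the right agree in the field.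
\<close>

lemma c_commutator:
  assumes "i \<in> I" "j \<in> I" "k \<in> I" "i + j + k = int q - 1"
  shows "c j k - c k j = of_nat (nat (j + k) choose nat (k + 1)) - of_nat (nat (j + k) choose nat (j + 1))"
proof -
  obtain b where b: "j = int b - 1" "b < q"
    using index_shift[OF assms(2)] .
  obtain d where d: "k = int d - 1" "d < q"
    using index_shift[OF assms(3)] .
  consider "i = -1" | "i = 0" | "i \<ge> 1"
    using assms(1) by (fastforce simp: I)
  thus ?thesis
  proof cases
    case 1
    hence jk: "nat (j + k) = q" "0 < nat (j + 1)" "nat (j + 1) < q" "0 < nat (k + 1)" "nat (k + 1) < q"
      "j + k \<notin> I" "k + j \<notin> I"
      using assms by (auto simp: I)
    show ?thesis
      unfolding jk(1) using choose_eq_0[OF jk(2,3)] choose_eq_0[OF jk(4,5)] c_outside[OF jk(6)] c_outside[OF jk(7)]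
      by simp
  next
    case 2
    have bd: "b + d = Suc q" "0 < q" "nat (j + k) = q - 1" "nat (j + 1) = b" "nat (k + 1) = d"
      "j + k \<notin> I" "k + j \<notin> I"
      using 2 assms b d by (auto simp: I)
    have pred: "(of_nat (q - 1 choose e) :: 'k) = (-1) ^ e" if "e < q" for e
      using of_nat_choose_pred[OF p q that] .
    have "(-1 :: 'k) ^ (b + d) = 1"
      using minus_one_power_pred[OF p q bd(2)] bd(1,2) by (cases q) simp_all
    hence "(-1 :: 'k) ^ b = (-1) ^ d"
      by (metis even_add power_minus1_even power_minus1_odd neg_one_even_power neg_one_odd_power)
    thus ?thesis
      unfolding bd(3,4,5) pred[OF b(2)] pred[OF d(2)] c_outside[OF bd(6)] c_outside[OF bd(7)] by simp
  next
    case 3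
    hence bd: "b + d \<le> q" "3 \<le> b + d"
      using assms b d by (auto simp: I)
    show ?thesis
    proof (cases "b = 0 \<or> d = 0")
      case True
      thus ?thesis
      proof
        assume "b = 0"
        then obtain d' where d': "d = Suc (Suc d')"
          using bd that[of "d - 2"] by simp
        have "c k j = 1"
          using c_nat[of "Suc d'" 0] b d d' \<open>b = 0\<close> by simp
        thus ?thesis
          using b d d' \<open>b = 0\<close> by (simp add: c_minus_one nat_add_distrib binomial_eq_0)
      next
        assume "d = 0"
        then obtain b' where b': "b = Suc (Suc b')"
          using bd that[of "b - 2"] by simp
        have "c j k = 1"
          using c_nat[of "Suc b'" 0] b d b' \<open>d = 0\<close> by simp
        thus ?thesis
          using b d b' \<open>d = 0\<close> by (simp add: c_minus_one nat_add_distrib binomial_eq_0)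
      qed
    next
      case False
      then obtain b' d' where b': "b = Suc b'" and d': "d = Suc d'"
        by (cases b; cases d) auto
      have "c j k = of_nat (Suc (b' + d') choose b')" "c k j = of_nat (Suc (b' + d') choose d')"
        using c_nat[of b' d] c_nat[of d' b] b d b' d' bd by (simp_all add: add.commute)
      moreover have "nat (j + k) = b' + d'" "nat (k + 1) = Suc d'" "nat (j + 1) = Suc b'"
        using b d b' d' by auto
      moreover have "Suc (b' + d') choose b' = (b' + d' choose d') + (b' + d' choose Suc d')"
        "Suc (b' + d') choose d' = (b' + d' choose b') + (b' + d' choose Suc b')"
        using binomial_symmetric[of b' "Suc (b' + d')"] binomial_symmetric[of d' "Suc (b' + d')"]
        by (simp_all add: Suc_diff_le)
      moreover have "b' + d' choose d' = b' + d' choose b'"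
        using binomial_symmetric[of b' "b' + d'"] by simp
      ultimately show ?thesis
        by (simp only: of_nat_add) simp
    qed
  qed
qed

text \<open>
  In degree \<open>q - 1\<close> the common factor \<open>(-1)\<^sup>i\<close> splits off; what remains cancels by \<open>c_sign\<close>, used twice, and
  \<open>c_commutator\<close>.
\<close>

lemma cocycle_coeffs_theta_trunc: "cocycle_coeffs I c \<theta>"
  unfolding cocycle_coeffs_def
proof (intro ballI)
  fix i j k assume ijk: "i \<in> I" "j \<in> I" "k \<in> I"
  show "- (c i j * \<theta> (i + j) k) + c i k * \<theta> (i + k) j + (c j k - c k j) * \<theta> i (j + k) = 0"
  proof (cases "i + j + k = int q - 1")
    case True
    have \<theta>: "\<theta> (i + j) k = - ((-1) powi i * (-1) powi j)" "\<theta> (i + k) j = - ((-1) powi i * (-1) powi k)"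
      "\<theta> i (j + k) = - ((-1) powi i)"
      using True by (simp_all add: theta_trunc_coeff_def add_ac power_int_add)
    have True': "i + k + j = int q - 1"
      using True by simp
    have "- (c i j * \<theta> (i + j) k) + c i k * \<theta> (i + k) j + (c j k - c k j) * \<theta> i (j + k) =
        (-1) powi i * (c i j * (-1) powi j - c i k * (-1) powi k - (c j k - c k j))"
      unfolding \<theta> by (simp add: algebra_simps)
    also have "\<dots> = 0"
      unfolding c_sign[OF ijk True] c_sign[OF ijk(1,3,2) True'] c_commutator[OF ijk True]
      by (simp add: add.commute)
    finally show ?thesis .
  qed (simp add: theta_trunc_coeff_def add_ac)
qed

text \<open>
  Coboundaries vanish in degree \<open>q - 1\<close>, which is outside of the index set, while \<open>\<vartheta>(e\<^sub>1, e\<^bsub>q-2\<^esub>) = 1\<close>.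
\<close>

lemma theta_trunc_nontrivial:
  assumes "q \<ge> 3"
  shows "\<exists>i\<in>I. \<exists>j\<in>I. \<theta> i j \<noteq> - c i j * w (i + j)"
proof -
  have "1 \<in> I" "int q - 2 \<in> I" "1 + (int q - 2) \<notin> I"
    using assms by (auto simp: I)
  moreover have "\<theta> 1 (int q - 2) = 1"
    by (simp add: theta_trunc_coeff_def)
  ultimately show ?thesis
    using c_outside[of 1 "int q - 2"] by (intro bexI[of _ 1] bexI[of _ "int q - 2"]) auto
qed

section \<open>All cocycles in positive characteristic\<close>

context
  fixes f :: "int \<Rightarrow> int \<Rightarrow> 'k"
  assumes f: "cocycle_coeffs I c f"
begin

lemma cocycle_rel: "i \<in> I \<Longrightarrow> j \<in> I \<Longrightarrow> k \<in> I \<Longrightarrow>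
    - (c i j * f (i + j) k) + c i k * f (i + k) j + (c j k - c k j) * f i (j + k) = 0"
  using f unfolding cocycle_coeffs_def by blast

lemma rel_e_0:
  assumes "i \<in> I" "j \<in> I"
  shows "of_int (i + j + 1) * f i j = c i j * f (i + j) 0"
proof -
  from cocycle_rel[OF assms zero_mem] show ?thesis
    using assms by (simp add: c_zero_left c_zero_right algebra_simps)
qed

text \<open>
  The case \<open>e\<^sub>k = e\<^bsub>-1\<^esub> = \<partial>\<close> of the cocycle condition.
\<close>

lemma rel_e_minus_one:
  assumes "i \<in> I" "j \<in> I" "0 \<le> i" "0 \<le> j"
  shows "f (i - 1) j + f i (j - 1) = c i j * f (i + j) (-1)"
proof -
  have "-1 \<in> I"
    using q_ge by (simp add: I)
  from cocycle_rel[OF assms(1,2) this] show ?thesis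
    using assms by (simp add: c_minus_one_right c_minus_one algebra_simps)
qed

text \<open>
  By \<open>c_pascal\<close> the difference \<open>D(i) = f(i, s-i) - c(i, s-i) f(s+1, -1)\<close> satisfies \<open>D(i-1) = - D(i)\<close>, and it vanishes
  at \<open>i = s + 1\<close>, since \<open>c(s+1, -1) = 1\<close>. The induction descends from there.
\<close>

lemma low_degree:
  assumes "i \<in> I" "j \<in> I" "i + j + 1 \<in> I" "0 \<le> i + j + 1"
  shows "f i j = c i j * f (i + j + 1) (-1)"
proof -
  define s where "s = i + j"
  have "f i (s - i) = c i (s - i) * f (s + 1) (-1)" if "i \<le> s + 1" "-1 \<le> i" for i
    using that
  proof (induction i rule: int_le_induct)
    case base
    thus ?case
      using c_minus_one_right[of "s + 1"] assms by (simp add: s_def)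
  next
    case (step i)
    have mem: "i \<in> I" "s + 1 - i \<in> I" "i + (s + 1 - i) \<in> I" and nn: "0 \<le> i" "0 \<le> s + 1 - i"
      using step assms(3) by (auto simp: I s_def)
    have eq: "f i (s - i) = c i (s - i) * f (s + 1) (-1)"
      using step nn by simp
    have "f (i - 1) (s + 1 - i) = c i (s + 1 - i) * f (s + 1) (-1) - f i (s - i)"
      using rel_e_minus_one[OF mem(1,2) nn] by (simp add: algebra_simps)
    also have "c i (s + 1 - i) = c (i - 1) (s + 1 - i) + c i (s - i)"
      using c_pascal[OF mem(1,2) nn mem(3)] by (simp add: algebra_simps)
    finally show ?case
      unfolding eq by (simp add: algebra_simps)
  qed
  from this[of i] show ?thesis
    using assms by (simp add: s_def I)
qed

text \<open>
  The value at the largest admissible \<open>i\<close> vanishes, and \<open>high_degree_alternates\<close> carries this to all others. In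
  characteristic \<open>2\<close> with \<open>q = 4\<close> the degree is \<open>4\<close> and \<open>s + 1 = 5\<close> is invertible.
\<close>

lemma high_degree_alternates:
  assumes "i \<in> I" "j \<in> I" "int q \<le> i + j" "0 \<le> i" "0 \<le> j"
  shows "f (i - 1) j = - f i (j - 1)"
proof -
  have "c i j = 0"
    using assms(3) by (intro c_outside) (simp add: I)
  hence "f (i - 1) j + f i (j - 1) = 0"
    using rel_e_minus_one[OF assms(1,2,4,5)] by simp
  thus ?thesis
    by (simp only: eq_neg_iff_add_eq_0)
qed

lemma degree_q_minus_1:
  assumes "i \<in> I" "j \<in> I" "i + j = int q - 1"
  shows "f i j = f 1 (int q - 2) * \<theta> i j"
proof -
  have "1 \<le> i" "i \<le> int q - 2" and j: "j = int q - 1 - i"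
    using assms by (auto simp: I)
  have "f i (int q - 1 - i) = f 1 (int q - 2) * - ((-1) powi i)"
    using \<open>1 \<le> i\<close> \<open>i \<le> int q - 2\<close>
  proof (induction i rule: int_ge_induct)
    case (step i)
    have "f i (int q - 1 - i) = - f (i + 1) (int q - 1 - (i + 1))"
      using high_degree_alternates[of "i + 1" "int q - 1 - i"] step by (simp add: I algebra_simps)
    thus ?case
      using step by (simp add: power_int_add minus_equation_iff)
  qed simp
  thus ?thesis
    using assms(3) unfolding j by (simp add: theta_trunc_coeff_def)
qed

text \<open>
  If \<open>s + 1\<close> is not \<open>0\<close> in the field, the condition with \<open>e\<^sub>0\<close> suffices. Otherwise take the condition for
  \<open>e\<^bsub>q-2\<^esub>\<close>, \<open>e\<^sub>j\<close> and \<open>e\<^sub>1\<close> with \<open>j = s + 1 - q\<close>, which is \<open>0\<close> in the field. The products of \<open>e\<^bsub>q-2\<^esub>\<close> with \<open>e\<^sub>j\<close> and \<open>e\<^sub>1\<close> are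
  out of range, and twice the structure constant of the commutator of \<open>e\<^sub>j\<close> and \<open>e\<^sub>1\<close> is \<open>(j + 2) (j - 1) = -2\<close>.
\<close>

lemma high_degree_corner:
  assumes "p \<noteq> 2" "int q \<le> s" "s \<le> 2 * int q - 4"
  shows "f (int q - 2) (s - (int q - 2)) = 0"
proof (cases "(of_int (s + 1) :: 'k) = 0")
  case False
  have "int q - 2 \<in> I" "s - (int q - 2) \<in> I" "int q - 2 + (s - (int q - 2)) \<notin> I"
    using assms by (auto simp: I)
  thus ?thesis
    using rel_e_0[of "int q - 2" "s - (int q - 2)"] False c_outside[of "int q - 2" "s - (int q - 2)"]
    by (auto simp: add.commute)
next
  case True
  have "\<not> p dvd 2"
    using assms(1) prime_p by (metis primes_dvd_imp_eq two_is_prime_nat)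
  hence two: "(2 :: 'k) \<noteq> 0"
    using p of_nat_eq_0_iff_char_dvd[where 'a = 'k, of 2] by simp
  define j where "j = s + 1 - int q"
  have j: "1 \<le> j" "j + 1 \<le> int q - 2"
    using assms by (auto simp: j_def)
  have mem: "int q - 2 \<in> I" "j \<in> I" "1 \<in> I" and out: "int q - 2 + j \<notin> I" "int q - 2 + 1 \<notin> I"
    using j by (auto simp: I)
  have "(c j 1 - c 1 j) * f (int q - 2) (j + 1) = 0"
    using cocycle_rel[OF mem] c_outside[OF out(1)] c_outside[OF out(2)] by simp
  moreover have "c j 1 - c 1 j \<noteq> 0"
  proof
    assume eq: "c j 1 - c 1 j = 0"
    define n where "n = nat j"
    have n: "j = int n" "n + 2 < q"
      using j by (auto simp: n_def)
    have "c j 1 = of_nat (n + 2 choose 2)"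
      using c_nat[of n 2] n binomial_symmetric[of n "n + 2"] by simp
    moreover have "c 1 j = of_nat (n + 2)"
      using c_nat[of 1 "n + 1"] n by (simp add: add.commute)
    moreover have "2 * (of_nat (n + 2 choose 2) :: 'k) = of_nat (n + 2) * of_nat (n + 1)"
    proof -
      have "2 * (n + 2 choose 2) = (n + 2) * (n + 1)"
        by (simp add: choose_two)
      thus ?thesis by (metis of_nat_mult of_nat_numeral)
    qed
    moreover have "(of_nat n :: 'k) = 0"
    proof -
      have "s + 1 = int n + int q"
        using n by (simp add: j_def)
      thus ?thesis
        using True of_nat_q by simp
    qed
    ultimately have "(1 + 1 :: 'k) = 0 + 1"
      using eq two by simp
    thus False
      by (simp only: add_right_cancel) simp
  qed
  ultimately show ?thesis
    by (simp add: j_def algebra_simps)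
qed

lemma high_degree:
  assumes "p \<noteq> 2 \<or> q = 4" "i \<in> I" "j \<in> I" "int q \<le> i + j"
  shows "f i j = 0"
proof -
  define s where "s = i + j"
  have bounds: "i \<le> int q - 2" "s - (int q - 2) \<le> i" and s: "int q \<le> s" "s \<le> 2 * int q - 4"
    using assms by (auto simp: I s_def)
  have corner: "f (int q - 2) (s - (int q - 2)) = 0"
  proof (cases "p = 2")
    case True
    hence q4: "q = 4" "s = 4"
      using assms s by auto
    have "(5 :: 'k) \<noteq> 0"
      using p True of_nat_eq_0_iff_char_dvd[where 'a = 'k, of 5] by simp
    thus ?thesis
      using rel_e_0[of 2 2] c_outside[of 2 2] q4 by (simp add: I)
  qed (use high_degree_corner s in blast)
  from bounds have "f i (s - i) = 0"
  proof (induction i rule: int_le_induct)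
    case base
    show ?case by (rule corner)
  next
    case (step i)
    have "f (i - 1) (s - i + 1) = - f i (s - i)"
      using high_degree_alternates[of i "s - i + 1"] step s by (simp add: I)
    thus ?case
      using step by (simp add: algebra_simps)
  qed
  thus ?thesis
    by (simp add: s_def)
qed

lemma cocycle_coeffs_char_p:
  assumes "p \<noteq> 2 \<or> q = 4"
  shows "\<exists>w t. \<forall>i\<in>I. \<forall>j\<in>I. f i j = - c i j * w (i + j) + t * \<theta> i j"
proof -
  \<comment> \<open>The index \<open>s + 1\<close> is available except in the top degree \<open>q - 2\<close>, where \<open>e\<^sub>0\<close> is used instead of \<open>e\<^bsub>-1\<^esub>\<close>.\<close>
  define w where "w s = (if s = int q - 2 then f s 0 else - f (s + 1) (-1))" for s
  have "f i j = - c i j * w (i + j) + f 1 (int q - 2) * \<theta> i j" if ij: "i \<in> I" "j \<in> I" for i j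
  proof -
    have "-1 \<le> i" "-1 \<le> j"
      using ij by (auto simp: I)
    hence "i + j = -2 \<or> (-1 \<le> i + j \<and> i + j \<le> int q - 3) \<or> i + j = int q - 2
        \<or> i + j = int q - 1 \<or> int q \<le> i + j"
      by linarith
    then consider "i + j = -2" | "-1 \<le> i + j" "i + j \<le> int q - 3" | "i + j = int q - 2"
      | "i + j = int q - 1" | "int q \<le> i + j"
      by blast
    thus ?thesis
    proof cases
      case 1
      hence "i = -1" "j = -1"
        using ij by (auto simp: I)
      thus ?thesis
        using rel_e_0[OF ij] q_ge by (simp add: c_minus_one theta_trunc_coeff_def)
    next
      case 2
      thus ?thesis
        using low_degree[OF ij] by (simp add: w_def theta_trunc_coeff_def I)
    next
      case 3
      have degree: "of_int (i + j + 1) = (-1 :: 'k)"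
        using 3 of_int_q by simp
      have "- f i j = c i j * f (i + j) 0"
        using rel_e_0[OF ij] unfolding degree by simp
      hence "f i j = - (c i j * f (i + j) 0)"
        by (metis minus_minus)
      thus ?thesis
        using 3 by (simp add: w_def theta_trunc_coeff_def)
    next
      case 4
      thus ?thesis
        using degree_q_minus_1[OF ij] c_outside[of i j] by (simp add: I)
    next
      case 5
      thus ?thesis
        using high_degree[OF assms ij] c_outside[of i j] by (simp add: I theta_trunc_coeff_def)
    qed
  qed
  thus ?thesis by blast
qed

end

end

section \<open>The cohomology of the algebras\<close>

lemma W1_rsym_trunc_eq:
  "(W1_rsym_trunc m :: ('k::field, int \<Rightarrow>\<^sub>0 'k) module) =
     graded_algebra (W1_index CHAR('k) m) divided_power_const"
  by (simp add: W1_rsym_trunc_def divided_power_const_def[abs_def])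

lemma theta_trunc_eq:
  "(theta_trunc m :: (int \<Rightarrow>\<^sub>0 'k::field) \<Rightarrow> _ \<Rightarrow> 'k) =
     graded_form (W1_index CHAR('k) m) (theta_trunc_coeff (CHAR('k) ^ m))"
  by (simp add: theta_trunc_def theta_trunc_coeff_def[abs_def])

lemma graded_algebra_cohomology:
  fixes I :: "int set" and \<gamma> h :: "int \<Rightarrow> int \<Rightarrow> 'k::field" and P :: bool
  defines "A \<equiv> graded_algebra I \<gamma>"
  assumes novikov: "novikov_consts I (structure_const I \<gamma>)"
    and zero_mem: "0 \<in> I"
    and unit: "\<And>j. j \<in> I \<Longrightarrow> structure_const I \<gamma> 0 j = 1"
    and cocycle: "cocycle_coeffs I (structure_const I \<gamma>) h"
    and nontrivial: "\<And>w. P \<Longrightarrow> \<exists>i\<in>I. \<exists>j\<in>I. h i j \<noteq> - structure_const I \<gamma> i j * w (i + j)"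
    and gen: "\<And>f. P \<Longrightarrow> cocycle_coeffs I (structure_const I \<gamma>) f \<Longrightarrow>
      \<exists>w t. \<forall>i\<in>I. \<forall>j\<in>I. f i j = - structure_const I \<gamma> i j * w (i + j) + t * h i j"
  shows "vectorspace class_ring (H2_rsym A) \<and>
         graded_form I h \<in> Z2_rsym A \<and>
         (P \<longrightarrow>
            vectorspace.fin_dim class_ring (H2_rsym A) \<and>
            vectorspace.dim class_ring (H2_rsym A) = 1 \<and>
            LinearCombinations.module.span class_ring (H2_rsym A) {cohomology_class A (graded_form I h)} =
              carrier (H2_rsym A)) \<and>
         vectorspace class_ring (H2_nov A) \<and>
         carrier (H2_nov A) = {\<zero>\<^bsub>H2_nov A\<^esub>} \<and>
         (\<forall>(E :: ('k, 'e) module) \<iota> \<pi>.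
            novikov_central_extension A E \<iota> \<pi> \<longrightarrow> split_extension A E \<pi>)"
proof -
  have nov: "novikov A"
    unfolding A_def using novikov by (rule novikov_graded_algebra)
  hence rsym: "right_symmetric A"
    by (simp add: novikov_def)
  let ?e = "Poly_Mapping.single 0 1 :: int \<Rightarrow>\<^sub>0 'k"
  have e: "?e \<in> carrier A" "\<And>a. a \<in> carrier A \<Longrightarrow> ?e \<otimes>\<^bsub>A\<^esub> a = a"
    unfolding A_def using zero_mem graded_left_unit[OF unit]
    by (simp_all add: graded_algebra_simps(1) del: single_one)
  have "vectorspace class_ring (H2_rsym A)"
    unfolding H2_rsym_def by (rule linear_quotient.vectorspace_quotient[OF linear_quotient_rsym[OF rsym]])
  moreover have "vectorspace class_ring (H2_nov A)"
    unfolding H2_nov_def by (rule linear_quotient.vectorspace_quotient[OF linear_quotient_nov[OF nov]])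
  moreover have "graded_form I h \<in> Z2_rsym A"
    unfolding A_def using cocycle by (rule graded_form_in_Z2_rsym)
  moreover have "carrier (H2_nov A) = {\<zero>\<^bsub>H2_nov A\<^esub>}"
    by (rule H2_nov_trivial[OF nov e])
  moreover have "split_extension A E \<pi>" if "novikov_central_extension A E \<iota> \<pi>"
    for E :: "('k, 'e) module" and \<iota> \<pi>
    using novikov_extension_splits[OF _ e that] nonassoc_graded_algebra unfolding A_def by blast
  moreover have "vectorspace.fin_dim class_ring (H2_rsym A)"
    "vectorspace.dim class_ring (H2_rsym A) = 1"
    "LinearCombinations.module.span class_ring (H2_rsym A) {cohomology_class A (graded_form I h)} =
       carrier (H2_rsym A)" if P
    unfolding A_def
    by (rule H2_rsym_graded_one_dimensional[OF rsym[unfolded A_def] cocycle nontrivial[OF that] gen[OF that]];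
        assumption)+
  ultimately show ?thesis by blast
qed

theorem theorem5p6:
  fixes A :: "('k::field, int \<Rightarrow>\<^sub>0 'k) module"
    and \<theta> :: "(int \<Rightarrow>\<^sub>0 'k) \<Rightarrow> (int \<Rightarrow>\<^sub>0 'k) \<Rightarrow> 'k"
    and m :: nat
  assumes "(CHAR('k) = 0 \<and> A = W1_rsym \<and> \<theta> = theta) \<or>
           (CHAR('k) > 0 \<and> m \<ge> 1 \<and> A = W1_rsym_trunc m \<and> \<theta> = theta_trunc m)"
  shows "vectorspace class_ring (H2_rsym A) \<and>
         \<theta> \<in> Z2_rsym A \<and>
         ((CHAR('k) = 2 \<longrightarrow> m = 2) \<longrightarrow>
            vectorspace.fin_dim class_ring (H2_rsym A) \<and>
            vectorspace.dim class_ring (H2_rsym A) = 1 \<and>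
            LinearCombinations.module.span class_ring (H2_rsym A) {cohomology_class A \<theta>} = carrier (H2_rsym A)) \<and>
         vectorspace class_ring (H2_nov A) \<and>
         carrier (H2_nov A) = {\<zero>\<^bsub>H2_nov A\<^esub>} \<and>
         (\<forall>(E :: ('k, 'e) module) \<iota> \<pi>.
            novikov_central_extension A E \<iota> \<pi> \<longrightarrow> split_extension A E \<pi>)"
  using assms
proof (elim disjE conjE)
  assume char: "CHAR('k) = 0" and A: "A = W1_rsym" and \<theta>: "\<theta> = theta"
  have unit: "W1_const 0 j = (1 :: 'k)" for j
    by (simp add: W1_const_def)
  show ?thesis
    unfolding A \<theta> W1_rsym_eq theta_eq
    by (rule graded_algebra_cohomology[where I = UNIV, unfolded structure_const_UNIV])
      (use theta_nontrivial[OF char] cocycle_coeffs_char_0[OF char] in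
        \<open>simp_all add: novikov_consts_W1 cocycle_coeffs_theta unit\<close>)
next
  assume char: "CHAR('k) > 0" and m: "m \<ge> 1" and A: "A = W1_rsym_trunc m" and \<theta>: "\<theta> = theta_trunc m"
  interpret truncated "CHAR('k)" m "CHAR('k) ^ m"
      "structure_const (W1_index CHAR('k) m) divided_power_const :: int \<Rightarrow> int \<Rightarrow> 'k" "W1_index CHAR('k) m"
    using char m by unfold_locales (simp_all add: W1_index_def)
  have q: "CHAR('k) \<noteq> 2 \<or> CHAR('k) ^ m = 4" if "CHAR('k) = 2 \<longrightarrow> m = 2"
    using that by auto
  have "CHAR('k) \<ge> 3" if "CHAR('k) \<noteq> 2"
    using that prime_ge_2_nat[OF prime_p] by simp
  hence q3: "CHAR('k) ^ m \<ge> 3" if "CHAR('k) = 2 \<longrightarrow> m = 2"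
    using q[OF that] q_ge(1) by linarith
  show ?thesis
    unfolding A \<theta> W1_rsym_trunc_eq theta_trunc_eq
    by (rule graded_algebra_cohomology[OF novikov_consts_c zero_mem c_zero_left cocycle_coeffs_theta_trunc
          theta_trunc_nontrivial[OF q3] cocycle_coeffs_char_p[OF _ q]])
qed

end
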